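(* Let $\Gamma$ be a divisible totally ordered abelian group and let $D$ be a cut in $\Gamma$. Then the extension $\Gamma\subset\Gamma(D)$ increases the rank if and only if $D$ is a ball cut.
   Context: A cut in an ordered abelian group $\Gamma$ is a pair $D=(D^L,D^R)$ of subsets with $D^L<D^R$ (elementwise) and $D^L\cup D^R=\Gamma$; the improper cuts $(\emptyset,\Gamma)$, $(\Gamma,\emptyset)$ are allowed. A cut is principal if it is of the form $a^+=(\Gamma_{\le a},\Gamma_{>a})$ or $a^-=(\Gamma_{<a},\Gamma_{\ge a})$ for some $a\in\Gamma$. The invariance group of $D$ is the convex subgroup $H(D)=\{h\in\Gamma\mid D^L+h=D^L\}$, where $\emptyset+h=\emptyset$ (so improper cuts have invariance group $\Gamma$). Writing $H=H(D)$, the pair $D/H=(D^L/H,D^R/H)$ of images in the ordered quotient $\Gamma/H$ is a cut in $\Gamma/H$; $D$ is a ball cut if $D/H$ is a principal cut in $\Gamma/H$. For $\Gamma$ divisible, $\Gamma(D)=x_D\mathbb{Z}\oplus\Gamma$, where $x_D$ is a formal symbol, equipped with the unique ordering compatible with the group structure, extending that of $\Gamma$, and satisfying $D^L<x_D<D^R$. For an ordered abelian group $G$, $\mathrm{Prin}(G)$ is the set of nonzero principal convex subgroups $H(a)=\{b\in G\mid |b|\le n|a|\text{ for some }n\in\mathbb{N}\}$, $0\neq a\in G$, ordered by descending inclusion. An extension $G\hookrightarrow\Lambda$ of ordered groups induces an embedding $\mathrm{Prin}(G)\hookrightarrow\mathrm{Prin}(\Lambda)$, sending a convex subgroup to the convex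 subgroup of $\Lambda$ it generates. The extension preserves the rank if $\mathrm{Prin}(\Lambda)\setminus\mathrm{Prin}(G)$ is empty, and increases the rank (by one) if this set has exactly one element. (For $\Gamma\subset\Gamma(D)$ one of these two cases always holds.) *)

theory Defs
  imports "HOL-Algebra.Elementary_Groups"
begin

section \<open>Ordered abelian groups\<close>

text \<open>Ordered abelian groups are carrier-based (and hence written multiplicatively, as
  in \<open>HOL-Algebra\<close>), since the quotient \<open>\<Gamma>/H\<close> by a subgroup depending on a given cut has to be an
  ordered abelian group in its own right. The order is a relation on the carrier in the sense of
  \<^const>\<open>linear_order_on\<close>.\<close>

record 'a ordered_group = "'a monoid" +
  ord_rel :: "('a \<times> 'a) set"

definition og_le :: "('a, 'b) ordered_group_scheme \<Rightarrow> 'a \<Rightarrow> 'a \<Rightarrow> bool" (infix \<open>\<preceq>\<index>\<close> 50)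
  where "a \<preceq>\<^bsub>G\<^esub> b \<longleftrightarrow> (a, b) \<in> ord_rel G"

definition og_less :: "('a, 'b) ordered_group_scheme \<Rightarrow> 'a \<Rightarrow> 'a \<Rightarrow> bool" (infix \<open>\<prec>\<index>\<close> 50)
  where "a \<prec>\<^bsub>G\<^esub> b \<longleftrightarrow> a \<preceq>\<^bsub>G\<^esub> b \<and> a \<noteq> b"

locale ordered_comm_group = comm_group G
  for G :: "('a, 'b) ordered_group_scheme" (structure) +
  assumes linear_order: "linear_order_on (carrier G) (ord_rel G)"
    and mult_left_mono:
      "\<lbrakk>a \<in> carrier G; b \<in> carrier G; c \<in> carrier G; a \<preceq> b\<rbrakk> \<Longrightarrow> c \<otimes> a \<preceq> c \<otimes> b"

definition divisible_group :: "('a, 'b) monoid_scheme \<Rightarrow> bool"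
  where "divisible_group G \<longleftrightarrow>
    (\<forall>a\<in>carrier G. \<forall>n::nat. n > 0 \<longrightarrow> (\<exists>b\<in>carrier G. b [^]\<^bsub>G\<^esub> n = a))"

definition with_order :: "('a, 'b) monoid_scheme \<Rightarrow> ('a \<times> 'a) set \<Rightarrow> 'a ordered_group"
  where "with_order M r = \<lparr>carrier = carrier M, mult = mult M, one = \<one>\<^bsub>M\<^esub>, ord_rel = r\<rparr>"

definition convex_subgroup :: "'a set \<Rightarrow> ('a, 'b) ordered_group_scheme \<Rightarrow> bool"
  where "convex_subgroup H G \<longleftrightarrow> subgroup H G \<and>
    (\<forall>a\<in>H. \<forall>b\<in>H. \<forall>c\<in>carrier G. a \<preceq>\<^bsub>G\<^esub> c \<and> c \<preceq>\<^bsub>G\<^esub> b \<longrightarrow> c \<in> H)"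

definition convex_hull_subgroup :: "('a, 'b) ordered_group_scheme \<Rightarrow> 'a set \<Rightarrow> 'a set"
  where "convex_hull_subgroup G S = \<Inter>{K. convex_subgroup K G \<and> S \<subseteq> K}"

text \<open>The order induced on the quotient by a convex subgroup: cosets are compared by
  representatives.\<close>

definition quotient_og ::
  "('a, 'b) ordered_group_scheme \<Rightarrow> 'a set \<Rightarrow> 'a set ordered_group"
  where "quotient_og G H = with_order (G Mod H)
    {(A, B). A \<in> carrier (G Mod H) \<and> B \<in> carrier (G Mod H) \<and> (\<exists>a\<in>A. \<exists>b\<in>B. a \<preceq>\<^bsub>G\<^esub> b)}"


section \<open>Cuts\<close>

definition is_cut :: "('a, 'b) ordered_group_scheme \<Rightarrow> 'a set \<times> 'a set \<Rightarrow> bool"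
  where "is_cut G D \<longleftrightarrow> fst D \<union> snd D = carrier G \<and> (\<forall>a\<in>fst D. \<forall>b\<in>snd D. a \<prec>\<^bsub>G\<^esub> b)"

definition cut_above :: "('a, 'b) ordered_group_scheme \<Rightarrow> 'a \<Rightarrow> 'a set \<times> 'a set"
  where "cut_above G a = ({x \<in> carrier G. x \<preceq>\<^bsub>G\<^esub> a}, {x \<in> carrier G. a \<prec>\<^bsub>G\<^esub> x})"

definition cut_below :: "('a, 'b) ordered_group_scheme \<Rightarrow> 'a \<Rightarrow> 'a set \<times> 'a set"
  where "cut_below G a = ({x \<in> carrier G. x \<prec>\<^bsub>G\<^esub> a}, {x \<in> carrier G. a \<preceq>\<^bsub>G\<^esub> x})"

definition principal_cut :: "('a, 'b) ordered_group_scheme \<Rightarrow> 'a set \<times> 'a set \<Rightarrow> bool"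
  where "principal_cut G D \<longleftrightarrow> is_cut G D \<and>
    (\<exists>a\<in>carrier G. D = cut_above G a \<or> D = cut_below G a)"

definition invariance_group :: "('a, 'b) ordered_group_scheme \<Rightarrow> 'a set \<times> 'a set \<Rightarrow> 'a set"
  where "invariance_group G D = {h \<in> carrier G. fst D #>\<^bsub>G\<^esub> h = fst D}"

definition cut_image ::
  "('a, 'b) ordered_group_scheme \<Rightarrow> 'a set \<Rightarrow> 'a set \<times> 'a set \<Rightarrow> 'a set set \<times> 'a set set"
  where "cut_image G H D = ((\<lambda>a. H #>\<^bsub>G\<^esub> a) ` fst D, (\<lambda>a. H #>\<^bsub>G\<^esub> a) ` snd D)"

definition ball_cut :: "('a, 'b) ordered_group_scheme \<Rightarrow> 'a set \<times> 'a set \<Rightarrow> bool"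
  where "ball_cut G D \<longleftrightarrow>
    principal_cut (quotient_og G (invariance_group G D)) (cut_image G (invariance_group G D) D)"


section \<open>The extension generated by a cut\<close>

text \<open>The pair \<open>(n, a)\<close> stands for \<open>n x\<^sub>D + a\<close>.\<close>

definition cut_ext_embed :: "'a \<Rightarrow> int \<times> 'a"
  where "cut_ext_embed a = (0, a)"

definition cut_ext_gen :: "('a, 'b) monoid_scheme \<Rightarrow> int \<times> 'a"
  where "cut_ext_gen G = (1, \<one>\<^bsub>G\<^esub>)"

definition is_cut_ext_order ::
  "('a, 'b) ordered_group_scheme \<Rightarrow> 'a set \<times> 'a set \<Rightarrow> ((int \<times> 'a) \<times> (int \<times> 'a)) set \<Rightarrow> bool"
  where "is_cut_ext_order G D r \<longleftrightarrow>
    (let E = with_order (integer_group \<times>\<times> G) r in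
      ordered_comm_group E \<and>
      (\<forall>a\<in>carrier G. \<forall>b\<in>carrier G. cut_ext_embed a \<preceq>\<^bsub>E\<^esub> cut_ext_embed b \<longleftrightarrow> a \<preceq>\<^bsub>G\<^esub> b) \<and>
      (\<forall>a\<in>fst D. cut_ext_embed a \<prec>\<^bsub>E\<^esub> cut_ext_gen G) \<and>
      (\<forall>b\<in>snd D. cut_ext_gen G \<prec>\<^bsub>E\<^esub> cut_ext_embed b))"

text \<open>For divisible \<open>G\<close> and a cut \<open>D\<close> the order described here exists and is unique; see
  \<open>ex1_cut_ext_order\<close> below.\<close>

definition cut_ext ::
  "('a, 'b) ordered_group_scheme \<Rightarrow> 'a set \<times> 'a set \<Rightarrow> (int \<times> 'a) ordered_group"
  where "cut_ext G D = with_order (integer_group \<times>\<times> G) (THE r. is_cut_ext_order G D r)"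


section \<open>Rank\<close>

definition og_abs :: "('a, 'b) ordered_group_scheme \<Rightarrow> 'a \<Rightarrow> 'a"
  where "og_abs G a = (if \<one>\<^bsub>G\<^esub> \<preceq>\<^bsub>G\<^esub> a then a else inv\<^bsub>G\<^esub> a)"

definition principal_convex_subgroup :: "('a, 'b) ordered_group_scheme \<Rightarrow> 'a \<Rightarrow> 'a set"
  where "principal_convex_subgroup G a =
    {b \<in> carrier G. \<exists>n::nat. og_abs G b \<preceq>\<^bsub>G\<^esub> og_abs G a [^]\<^bsub>G\<^esub> n}"

text \<open>The order of \<open>Prin(G)\<close> by descending inclusion plays no role for whether an extension
  increases the rank, so only the underlying set is defined.\<close>

definition Prin :: "('a, 'b) ordered_group_scheme \<Rightarrow> 'a set set"
  where "Prin G = principal_convex_subgroup G ` (carrier G - {\<one>\<^bsub>G\<^esub>})"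

definition Prin_map :: "('b, 'c) ordered_group_scheme \<Rightarrow> ('a \<Rightarrow> 'b) \<Rightarrow> 'a set \<Rightarrow> 'b set"
  where "Prin_map L \<iota> H = convex_hull_subgroup L (\<iota> ` H)"

definition increases_rank ::
  "('a, 'c) ordered_group_scheme \<Rightarrow> ('b, 'd) ordered_group_scheme \<Rightarrow> ('a \<Rightarrow> 'b) \<Rightarrow> bool"
  where "increases_rank G L \<iota> \<longleftrightarrow> is_singleton (Prin L - Prin_map L \<iota> ` Prin G)"


section \<open>Existence and uniqueness of the order on the extension\<close>

lemma with_order_simps [simp]:
  "carrier (with_order M r) = carrier M" "mult (with_order M r) = mult M"
  "one (with_order M r) = one M" "ord_rel (with_order M r) = r"
  by (simp_all add: with_order_def)

lemma og_le_with_order [simp]: "a \<preceq>\<^bsub>with_order M r\<^esub> b \<longleftrightarrow> (a, b) \<in> r"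
  by (simp add: og_le_def)

lemma comm_group_with_order [simp]: "comm_group (with_order M r) \<longleftrightarrow> comm_group M"
  unfolding comm_group_def comm_monoid_def comm_monoid_axioms_def group_def group_axioms_def
    monoid_def Units_def
  by simp

context ordered_comm_group
begin

lemma og_refl [simp]: "a \<in> carrier G \<Longrightarrow> a \<preceq> a"
  using linear_order by (auto simp: order_on_defs refl_on_def og_le_def)

lemma og_trans: "a \<preceq> b \<Longrightarrow> b \<preceq> c \<Longrightarrow> a \<preceq> c"
  using linear_order unfolding order_on_defs og_le_def by (meson transD)

lemma og_antisym: "a \<preceq> b \<Longrightarrow> b \<preceq> a \<Longrightarrow> a = b"
  using linear_order unfolding order_on_defs og_le_def by (meson antisymD)

lemma og_total: "a \<in> carrier G \<Longrightarrow> b \<in> carrier G \<Longrightarrow> a \<preceq> b \<or> b \<preceq> a"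
  using linear_order og_refl unfolding order_on_defs og_le_def total_on_def by metis

lemma og_le_carrier: "a \<preceq> b \<Longrightarrow> a \<in> carrier G \<and> b \<in> carrier G"
  using linear_order unfolding order_on_defs og_le_def by blast

lemma mult_mono:
  assumes "a \<preceq> b" "c \<preceq> d" shows "a \<otimes> c \<preceq> b \<otimes> d"
proof -
  have c: "a \<in> carrier G" "b \<in> carrier G" "c \<in> carrier G" "d \<in> carrier G"
    using assms og_le_carrier by auto
  have "a \<otimes> c \<preceq> a \<otimes> d" using assms c mult_left_mono by simp
  also have "d \<otimes> a \<preceq> d \<otimes> b" using assms c mult_left_mono by simp
  hence "a \<otimes> d \<preceq> b \<otimes> d" using c by (simp add: m_comm)
  finally (og_trans) show ?thesis .
qed

lemma le_iff_one_le:
  assumes "a \<in> carrier G" "b \<in> carrier G"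
  shows "a \<preceq> b \<longleftrightarrow> \<one> \<preceq> b \<otimes> inv a"
proof
  assume "a \<preceq> b"
  from mult_left_mono[OF _ _ _ this, of "inv a"] show "\<one> \<preceq> b \<otimes> inv a"
    using assms by (simp add: m_comm)
next
  assume "\<one> \<preceq> b \<otimes> inv a"
  from mult_left_mono[OF _ _ _ this, of a] have "a \<preceq> a \<otimes> (b \<otimes> inv a)" using assms by simp
  also have "a \<otimes> (b \<otimes> inv a) = b"
    using assms m_comm[of b "inv a"] m_assoc[of a "inv a" b] by simp
  finally show "a \<preceq> b" .
qed

lemma one_le_mult: "\<one> \<preceq> a \<Longrightarrow> \<one> \<preceq> b \<Longrightarrow> \<one> \<preceq> a \<otimes> b"
  using mult_mono[of \<one> a \<one> b] by simp

lemma one_le_mult_eq: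
  assumes "\<one> \<preceq> a" "\<one> \<preceq> b" "a \<otimes> b = \<one>" shows "a = \<one>"
proof -
  have c: "a \<in> carrier G" "b \<in> carrier G" using assms og_le_carrier by auto
  have "a \<preceq> a \<otimes> b" using mult_mono[OF og_refl[OF c(1)] assms(2)] c by simp
  thus ?thesis using assms og_antisym by auto
qed

lemma one_le_pow: "\<one> \<preceq> a \<Longrightarrow> \<one> \<preceq> a [^] (n::nat)"
proof (induction n)
  case (Suc n)
  thus ?case using one_le_mult by simp
qed simp

lemma one_le_int_pow:
  assumes "\<one> \<preceq> a" "n \<ge> 0" shows "\<one> \<preceq> a [^] (n::int)"
  using one_le_pow[OF assms(1), of "nat n"] unfolding pow_nat[OF assms(2)] .

lemma int_pow_mono:
  assumes "a \<preceq> b" "n \<ge> 0" shows "a [^] (n::int) \<preceq> b [^] n"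
proof -
  have c: "a \<in> carrier G" "b \<in> carrier G" using assms og_le_carrier by auto
  have "\<one> \<preceq> b \<otimes> inv a" using le_iff_one_le[OF c] assms(1) by blast
  from one_le_int_pow[OF this assms(2)] have "\<one> \<preceq> b [^] n \<otimes> inv (a [^] n)"
    using c by (simp add: int_pow_distrib int_pow_inv)
  thus ?thesis using c le_iff_one_le[of "a [^] n" "b [^] n"] by simp
qed

lemma int_pow_antimono:
  assumes "a \<preceq> b" "n \<le> 0" shows "b [^] (n::int) \<preceq> a [^] n"
proof -
  have c: "a \<in> carrier G" "b \<in> carrier G" using assms og_le_carrier by auto
  have "\<one> \<preceq> b \<otimes> inv a" using le_iff_one_le[OF c] assms(1) by blast
  hence "\<one> \<preceq> (b \<otimes> inv a) [^] (- n)" using one_le_int_pow assms(2) by simp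
  also have "(b \<otimes> inv a) [^] (- n) = b [^] (- n) \<otimes> inv a [^] (- n)"
    using c by (simp add: int_pow_distrib)
  also have "\<dots> = inv (b [^] n) \<otimes> a [^] n" using c by (simp add: int_pow_neg int_pow_inv)
  also have "\<dots> = a [^] n \<otimes> inv (b [^] n)" using c by (simp add: m_comm)
  finally have "\<one> \<preceq> a [^] n \<otimes> inv (b [^] n)" .
  thus ?thesis using c le_iff_one_le[of "b [^] n" "a [^] n"] by simp
qed

lemma one_less_int_pow:
  assumes "\<one> \<preceq> a" "a \<noteq> \<one>" "n > 0" shows "a [^] (n::int) \<noteq> \<one>"
proof
  assume e: "a [^] n = \<one>"
  have c: "a \<in> carrier G" using og_le_carrier[OF assms(1)] by simp
  have "a [^] (1 + (n - 1)) = a [^] (1::int) \<otimes> a [^] (n - 1)" by (rule int_pow_mult[OF c])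
  hence "a \<otimes> a [^] (n - 1) = \<one>" using e c by simp
  moreover have "\<one> \<preceq> a [^] (n - 1)" using one_le_int_pow[OF assms(1)] assms(3) by simp
  ultimately show False using one_le_mult_eq[OF assms(1)] assms(2) by blast
qed

end

lemma ordered_comm_groupI_cone:
  assumes M: "comm_group M" and sub: "P \<subseteq> carrier M" and one: "\<one>\<^bsub>M\<^esub> \<notin> P"
    and closed: "\<And>x y. x \<in> P \<Longrightarrow> y \<in> P \<Longrightarrow> x \<otimes>\<^bsub>M\<^esub> y \<in> P"
    and total: "\<And>x. x \<in> carrier M \<Longrightarrow> x = \<one>\<^bsub>M\<^esub> \<or> x \<in> P \<or> inv\<^bsub>M\<^esub> x \<in> P"
  shows "ordered_comm_group (with_order M
    {(x, y). x \<in> carrier M \<and> y \<in> carrier M \<and> (x = y \<or> y \<otimes>\<^bsub>M\<^esub> inv\<^bsub>M\<^esub> x \<in> P)})"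
    (is "ordered_comm_group (with_order M ?r)")
proof -
  interpret M: comm_group M by (rule M)
  have tr: "(x, z) \<in> ?r" if "(x, y) \<in> ?r" "(y, z) \<in> ?r" for x y z
  proof -
    have c: "x \<in> carrier M" "y \<in> carrier M" "z \<in> carrier M" using that by auto
    have "(z \<otimes>\<^bsub>M\<^esub> inv\<^bsub>M\<^esub> y) \<otimes>\<^bsub>M\<^esub> (y \<otimes>\<^bsub>M\<^esub> inv\<^bsub>M\<^esub> x) = z \<otimes>\<^bsub>M\<^esub> inv\<^bsub>M\<^esub> x"
      using c by (metis M.inv_closed M.m_assoc M.m_closed M.l_inv M.l_one)
    thus ?thesis using that closed[of "z \<otimes>\<^bsub>M\<^esub> inv\<^bsub>M\<^esub> y" "y \<otimes>\<^bsub>M\<^esub> inv\<^bsub>M\<^esub> x"] by auto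
  qed
  have inv: "inv\<^bsub>M\<^esub> (y \<otimes>\<^bsub>M\<^esub> inv\<^bsub>M\<^esub> x) = x \<otimes>\<^bsub>M\<^esub> inv\<^bsub>M\<^esub> y"
    if "x \<in> carrier M" "y \<in> carrier M" for x y
    using that by (simp add: M.inv_mult_group)
  have an: "x = y" if "(x, y) \<in> ?r" "(y, x) \<in> ?r" for x y
  proof (rule ccontr)
    assume "x \<noteq> y"
    with that have c: "x \<in> carrier M" "y \<in> carrier M"
      and p: "y \<otimes>\<^bsub>M\<^esub> inv\<^bsub>M\<^esub> x \<in> P" "x \<otimes>\<^bsub>M\<^esub> inv\<^bsub>M\<^esub> y \<in> P" by auto
    have "(y \<otimes>\<^bsub>M\<^esub> inv\<^bsub>M\<^esub> x) \<otimes>\<^bsub>M\<^esub> (x \<otimes>\<^bsub>M\<^esub> inv\<^bsub>M\<^esub> y) = \<one>\<^bsub>M\<^esub>"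
      using inv[OF c] c by (metis M.inv_closed M.m_closed M.r_inv)
    with closed[OF p] one show False by simp
  qed
  have to: "(x, y) \<in> ?r \<or> (y, x) \<in> ?r" if c: "x \<in> carrier M" "y \<in> carrier M" for x y
  proof -
    have "x = y" if "y \<otimes>\<^bsub>M\<^esub> inv\<^bsub>M\<^esub> x = \<one>\<^bsub>M\<^esub>"
      using that c by (metis M.inv_closed M.inv_equality M.inv_inv)
    with total[of "y \<otimes>\<^bsub>M\<^esub> inv\<^bsub>M\<^esub> x"] inv[OF c] c show ?thesis by auto
  qed
  have mono: "(c \<otimes>\<^bsub>M\<^esub> x, c \<otimes>\<^bsub>M\<^esub> y) \<in> ?r" if "(x, y) \<in> ?r" "c \<in> carrier M" for c x y
  proof -
    have c: "x \<in> carrier M" "y \<in> carrier M" using that by auto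
    have "(c \<otimes>\<^bsub>M\<^esub> y) \<otimes>\<^bsub>M\<^esub> inv\<^bsub>M\<^esub> (c \<otimes>\<^bsub>M\<^esub> x) = y \<otimes>\<^bsub>M\<^esub> inv\<^bsub>M\<^esub> x"
    proof -
      have "(c \<otimes>\<^bsub>M\<^esub> y) \<otimes>\<^bsub>M\<^esub> inv\<^bsub>M\<^esub> (c \<otimes>\<^bsub>M\<^esub> x)
          = (y \<otimes>\<^bsub>M\<^esub> c) \<otimes>\<^bsub>M\<^esub> (inv\<^bsub>M\<^esub> c \<otimes>\<^bsub>M\<^esub> inv\<^bsub>M\<^esub> x)"
        using c that by (simp add: M.inv_mult M.m_comm)
      also have "\<dots> = y \<otimes>\<^bsub>M\<^esub> (c \<otimes>\<^bsub>M\<^esub> inv\<^bsub>M\<^esub> c \<otimes>\<^bsub>M\<^esub> inv\<^bsub>M\<^esub> x)"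
        using c that(2) by (metis M.m_assoc M.m_closed M.inv_closed)
      finally show ?thesis using c that(2) by simp
    qed
    thus ?thesis using that by auto
  qed
  have "linear_order_on (carrier M) ?r"
    unfolding order_on_defs
  proof (intro conjI)
    show "?r \<subseteq> carrier M \<times> carrier M" "refl_on (carrier M) ?r" by (auto simp: refl_on_def)
    show "trans ?r" using tr by (rule transI)
    show "antisym ?r" using an by (rule antisymI)
    show "total_on (carrier M) ?r" using to by (intro total_onI)
  qed
  then show ?thesis
    using M mono by (auto simp: ordered_comm_group_def ordered_comm_group_axioms_def)
qed

context ordered_comm_group
begin

text \<open>The positive cone of \<open>\<Gamma>(D)\<close>; an element \<open>(n, a)\<close> is evaluated at \<open>d\<close> close to the cut.\<close>

definition cut_cone :: "'a set \<times> 'a set \<Rightarrow> (int \<times> 'a) set"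
  where "cut_cone D = {(n, a). a \<in> carrier G \<and>
    (n = 0 \<longrightarrow> \<one> \<preceq> a \<and> a \<noteq> \<one>) \<and>
    (n > 0 \<longrightarrow> (\<exists>d\<in>fst D. \<one> \<preceq> d [^] n \<otimes> a)) \<and>
    (n < 0 \<longrightarrow> (\<exists>d\<in>snd D. \<one> \<preceq> d [^] n \<otimes> a))}"

lemma inv_DirProd_integer:
  assumes "a \<in> carrier G"
  shows "inv\<^bsub>integer_group \<times>\<times> G\<^esub> (n, a) = (- n, inv a)"
  using assms by (simp add: group.inv_eq_1_iff inv_DirProd group_integer_group is_group)

lemma comm_group_DirProd_integer: "comm_group (integer_group \<times>\<times> G)"
proof -
  interpret P: group "integer_group \<times>\<times> G"
    by (intro DirProd_group group_integer_group is_group)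
  show ?thesis by (rule P.group_comm_groupI) (auto simp: m_comm)
qed

lemma eval_mult:
  assumes "d \<in> carrier G" "a \<in> carrier G" "b \<in> carrier G"
  shows "d [^] (m + n :: int) \<otimes> (a \<otimes> b) = (d [^] m \<otimes> a) \<otimes> (d [^] n \<otimes> b)"
  using assms by (simp add: int_pow_mult m_ac)

lemma cut_cone_closed:
  assumes D: "is_cut G D" and x: "(m, a) \<in> cut_cone D" and y: "(n, b) \<in> cut_cone D"
  shows "(m + n, a \<otimes> b) \<in> cut_cone D"
proof -
  have cD: "fst D \<subseteq> carrier G" "snd D \<subseteq> carrier G" using D by (auto simp: is_cut_def)
  have lr: "d \<preceq> e" "d \<noteq> e" if "d \<in> fst D" "e \<in> snd D" for d e
    using D that by (auto simp: is_cut_def og_less_def)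
  have ca: "a \<in> carrier G" and cb: "b \<in> carrier G" using x y by (auto simp: cut_cone_def)
  have mem: "(k, c) \<in> cut_cone D"
    if "c \<in> carrier G" "k = 0 \<Longrightarrow> \<one> \<preceq> c \<and> c \<noteq> \<one>"
      "k > 0 \<Longrightarrow> \<exists>d\<in>fst D. \<one> \<preceq> d [^] k \<otimes> c" "k < 0 \<Longrightarrow> \<exists>d\<in>snd D. \<one> \<preceq> d [^] k \<otimes> c"
    for k c using that by (simp add: cut_cone_def)
  have up: "\<one> \<preceq> e [^] k \<otimes> c"
    if "\<one> \<preceq> d [^] k \<otimes> c" "c \<in> carrier G" "d \<preceq> e" "k \<ge> 0" for d e c and k :: int
    using mult_mono[OF int_pow_mono[OF that(3,4)] og_refl[OF that(2)]] that(1) og_trans by blast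
  have down: "\<one> \<preceq> d [^] k \<otimes> c"
    if "\<one> \<preceq> e [^] k \<otimes> c" "c \<in> carrier G" "d \<preceq> e" "k \<le> 0" for d e c and k :: int
    using mult_mono[OF int_pow_antimono[OF that(3,4)] og_refl[OF that(2)]] that(1) og_trans by blast
  have at: "\<one> \<preceq> d [^] (k + l) \<otimes> (c \<otimes> c')"
    if "d \<in> carrier G" "c \<in> carrier G" "c' \<in> carrier G" "\<one> \<preceq> d [^] k \<otimes> c" "\<one> \<preceq> d [^] l \<otimes> c'"
    for d c c' and k l :: int
    using one_le_mult[OF that(4,5)] eval_mult[OF that(1-3)] by simp
  have mixed: "(k + l, c \<otimes> c') \<in> cut_cone D"
    if k: "k > 0" and l: "l < 0" and kc: "(k, c) \<in> cut_cone D" and lc: "(l, c') \<in> cut_cone D"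
    for k l c c'
  proof -
    obtain d where d: "d \<in> fst D" "\<one> \<preceq> d [^] k \<otimes> c" using kc k by (auto simp: cut_cone_def)
    obtain e where e: "e \<in> snd D" "\<one> \<preceq> e [^] l \<otimes> c'" using lc l by (auto simp: cut_cone_def)
    have cc: "c \<in> carrier G" "c' \<in> carrier G" "d \<in> carrier G" "e \<in> carrier G"
      using kc lc d e cD by (auto simp: cut_cone_def)
    have e': "\<one> \<preceq> e [^] k \<otimes> c" using up[OF d(2) cc(1) lr(1)[OF d(1) e(1)]] k by simp
    have d': "\<one> \<preceq> d [^] l \<otimes> c'" using down[OF e(2) cc(2) lr(1)[OF d(1) e(1)]] l by simp
    note atd = at[OF cc(3,1,2) d(2) d'] and ate = at[OF cc(4,1,2) e' e(2)]
    show ?thesis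
    proof (rule mem)
      assume z: "k + l = 0"
      have "c \<otimes> c' \<noteq> \<one>"
      proof
        assume eq: "c \<otimes> c' = \<one>"
        have "(e [^] k \<otimes> c) \<otimes> (e [^] l \<otimes> c') = \<one>"
          using eval_mult[OF cc(4,1,2), of k l] z eq by simp
        from one_le_mult_eq[OF e' e(2) this] have 1: "e [^] k \<otimes> c = \<one>" .
        have "(d [^] k \<otimes> c) \<otimes> (d [^] l \<otimes> c') = \<one>"
          using eval_mult[OF cc(3,1,2), of k l] z eq by simp
        from one_le_mult_eq[OF d(2) d' this] have 2: "d [^] k \<otimes> c = \<one>" .
        from 1 2 have "e [^] k = d [^] k" using cc by (metis int_pow_closed right_cancel)
        hence "(e \<otimes> inv d) [^] k = \<one>"
          using cc by (simp add: int_pow_distrib int_pow_inv)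
        moreover have "\<one> \<preceq> e \<otimes> inv d" using lr(1)[OF d(1) e(1)] le_iff_one_le[of d e] cc by simp
        moreover have "e \<otimes> inv d \<noteq> \<one>"
          using lr(2)[OF d(1) e(1)] cc by (metis inv_closed inv_equality inv_inv)
        ultimately show False using one_less_int_pow k by blast
      qed
      thus "\<one> \<preceq> c \<otimes> c' \<and> c \<otimes> c' \<noteq> \<one>" using atd z cc by simp
    qed (use atd ate d e cc in auto)
  qed
  have zero: "(l, c \<otimes> c') \<in> cut_cone D"
    if zc: "(0, c) \<in> cut_cone D" and lc: "(l, c') \<in> cut_cone D" for l c c'
  proof -
    have cc: "c \<in> carrier G" "c' \<in> carrier G" and c1: "\<one> \<preceq> c" "c \<noteq> \<one>"
      using zc lc by (auto simp: cut_cone_def)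
    have s: "\<one> \<preceq> d [^] l \<otimes> (c \<otimes> c')" if "d \<in> carrier G" "\<one> \<preceq> d [^] l \<otimes> c'" for d
      using at[of d c c' 0 l] that cc c1 by simp
    show ?thesis
    proof (rule mem)
      assume "l = 0"
      hence c2: "\<one> \<preceq> c'" using lc by (auto simp: cut_cone_def)
      show "\<one> \<preceq> c \<otimes> c' \<and> c \<otimes> c' \<noteq> \<one>"
        using one_le_mult[OF c1(1) c2] one_le_mult_eq[OF c1(1) c2] c1(2) by blast
    next
      assume "l > 0"
      then obtain d where "d \<in> fst D" "\<one> \<preceq> d [^] l \<otimes> c'" using lc by (auto simp: cut_cone_def)
      with s cD show "\<exists>d\<in>fst D. \<one> \<preceq> d [^] l \<otimes> (c \<otimes> c')" by blast
    next
      assume "l < 0"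
      then obtain d where "d \<in> snd D" "\<one> \<preceq> d [^] l \<otimes> c'" using lc by (auto simp: cut_cone_def)
      with s cD show "\<exists>d\<in>snd D. \<one> \<preceq> d [^] l \<otimes> (c \<otimes> c')" by blast
    qed (use cc in auto)
  qed
  consider "m = 0" | "n = 0" | "m > 0" "n < 0" | "m < 0" "n > 0" | "m > 0" "n > 0"
    | "m < 0" "n < 0" by linarith
  thus ?thesis
  proof cases
    case 1 thus ?thesis using zero[of a n b] x y by simp
  next
    case 2 thus ?thesis using zero[of b m a] x y by (simp add: m_comm ca cb)
  next
    case 3 thus ?thesis using mixed x y by blast
  next
    case 4 thus ?thesis using mixed[of n m b a] x y by (simp add: m_comm ca cb add.commute)
  next
    case 5
    then obtain d e where d: "d \<in> fst D" "\<one> \<preceq> d [^] m \<otimes> a" and e: "e \<in> fst D" "\<one> \<preceq> e [^] n \<otimes> b"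
      using x y by (auto simp: cut_cone_def)
    have cc: "d \<in> carrier G" "e \<in> carrier G" using d e cD by auto
    have "\<exists>f\<in>fst D. \<one> \<preceq> f [^] (m + n) \<otimes> (a \<otimes> b)"
      using og_total[OF cc]
    proof
      assume "d \<preceq> e"
      from at[OF cc(2) ca cb up[OF d(2) ca this] e(2)] 5 e(1) show ?thesis by auto
    next
      assume "e \<preceq> d"
      from at[OF cc(1) ca cb d(2) up[OF e(2) cb this]] 5 d(1) show ?thesis by auto
    qed
    thus ?thesis using mem[of "a \<otimes> b" "m + n"] 5 ca cb by auto
  next
    case 6
    then obtain d e where d: "d \<in> snd D" "\<one> \<preceq> d [^] m \<otimes> a" and e: "e \<in> snd D" "\<one> \<preceq> e [^] n \<otimes> b"
      using x y by (auto simp: cut_cone_def)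
    have cc: "d \<in> carrier G" "e \<in> carrier G" using d e cD by auto
    have "\<exists>f\<in>snd D. \<one> \<preceq> f [^] (m + n) \<otimes> (a \<otimes> b)"
      using og_total[OF cc]
    proof
      assume "d \<preceq> e"
      from at[OF cc(1) ca cb d(2) down[OF e(2) cb this]] 6 d(1) show ?thesis by auto
    next
      assume "e \<preceq> d"
      from at[OF cc(2) ca cb down[OF d(2) ca this] e(2)] 6 e(1) show ?thesis by auto
    qed
    thus ?thesis using mem[of "a \<otimes> b" "m + n"] 6 ca cb by auto
  qed
qed

lemma cut_cone_total:
  assumes D: "is_cut G D" and div: "divisible_group G" and a: "a \<in> carrier G"
  shows "(n, a) = (0, \<one>) \<or> (n, a) \<in> cut_cone D \<or> (- n, inv a) \<in> cut_cone D"
proof (cases "n = 0")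
  case True
  have "\<one> \<preceq> inv a" if "a \<preceq> \<one>" using le_iff_one_le[of a \<one>] that a by simp
  with True og_total[of a \<one>] a show ?thesis by (auto simp: cut_cone_def)
next
  case False
  have "nat \<bar>n\<bar> > 0" using False by simp
  then obtain c where c: "c \<in> carrier G" "c [^] nat \<bar>n\<bar> = a"
    using div a unfolding divisible_group_def by blast
  hence c': "c [^] \<bar>n\<bar> = a" using pow_nat[of "\<bar>n\<bar>" G c] by simp
  define d where "d = (if n > 0 then inv c else c)"
  have d: "d \<in> carrier G" using c(1) by (simp add: d_def)
  have dn: "d [^] n = inv a"
  proof (cases "n > 0")
    case True
    thus ?thesis using c' int_pow_inv[OF c(1), of n] by (simp add: d_def)
  next
    case F: False
    hence "inv (c [^] n) = a" using c' int_pow_neg[OF c(1), of n] by simp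
    hence "inv a = c [^] n" using inv_inv[OF int_pow_closed[OF c(1), of n]] by simp
    thus ?thesis using F by (simp add: d_def)
  qed
  have 1: "d [^] n \<otimes> a = \<one>" using dn a by simp
  have 2: "d [^] (- n) \<otimes> inv a = \<one>" using dn a int_pow_neg[OF d, of n] by simp
  have 3: "\<one> \<preceq> d [^] n \<otimes> a" "\<one> \<preceq> d [^] (- n) \<otimes> inv a" unfolding 1 2 by simp_all
  have "d \<in> fst D \<or> d \<in> snd D" using d D by (auto simp: is_cut_def)
  moreover have "n > 0 \<or> n < 0" using False by linarith
  ultimately consider "n > 0" "d \<in> fst D" | "n < 0" "d \<in> snd D"
    | "n > 0" "d \<in> snd D" | "n < 0" "d \<in> fst D" by blast
  thus ?thesis
  proof cases
    case 1
    with 3(1) a have "(n, a) \<in> cut_cone D" unfolding cut_cone_def by auto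
    thus ?thesis by blast
  next
    case 2
    with 3(1) a have "(n, a) \<in> cut_cone D" unfolding cut_cone_def by auto
    thus ?thesis by blast
  next
    case 3: 3
    have "(- n, inv a) \<in> cut_cone D"
      using 3 \<open>\<one> \<preceq> d [^] (- n) \<otimes> inv a\<close> a unfolding cut_cone_def by auto
    thus ?thesis by blast
  next
    case 4
    have "(- n, inv a) \<in> cut_cone D"
      using 4 \<open>\<one> \<preceq> d [^] (- n) \<otimes> inv a\<close> a unfolding cut_cone_def by auto
    thus ?thesis by blast
  qed
qed

definition cut_rel :: "'a set \<times> 'a set \<Rightarrow> ((int \<times> 'a) \<times> (int \<times> 'a)) set"
  where "cut_rel D = {(x, y). x \<in> carrier (integer_group \<times>\<times> G) \<and> y \<in> carrier (integer_group \<times>\<times> G) \<and>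
    (x = y \<or> y \<otimes>\<^bsub>integer_group \<times>\<times> G\<^esub> inv\<^bsub>integer_group \<times>\<times> G\<^esub> x \<in> cut_cone D)}"

lemma is_cut_ext_order_cut_rel:
  assumes D: "is_cut G D" and div: "divisible_group G"
  shows "is_cut_ext_order G D (cut_rel D)"
proof -
  have cD: "fst D \<subseteq> carrier G" "snd D \<subseteq> carrier G" using D by (auto simp: is_cut_def)
  have "ordered_comm_group (with_order (integer_group \<times>\<times> G) (cut_rel D))"
    unfolding cut_rel_def
  proof (rule ordered_comm_groupI_cone[OF comm_group_DirProd_integer])
    show "cut_cone D \<subseteq> carrier (integer_group \<times>\<times> G)" by (auto simp: cut_cone_def)
    show "\<one>\<^bsub>integer_group \<times>\<times> G\<^esub> \<notin> cut_cone D" by (simp add: cut_cone_def)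
    show "x \<otimes>\<^bsub>integer_group \<times>\<times> G\<^esub> y \<in> cut_cone D" if "x \<in> cut_cone D" "y \<in> cut_cone D" for x y
      using cut_cone_closed[OF D, of "fst x" "snd x" "fst y" "snd y"] that
      by (simp add: mult_DirProd')
    show "x = \<one>\<^bsub>integer_group \<times>\<times> G\<^esub> \<or> x \<in> cut_cone D \<or> inv\<^bsub>integer_group \<times>\<times> G\<^esub> x \<in> cut_cone D"
      if "x \<in> carrier (integer_group \<times>\<times> G)" for x
      using cut_cone_total[OF D div, of "snd x" "fst x"] that
      by (cases x) (auto simp: inv_DirProd_integer)
  qed
  moreover have "((0, a), (0, b)) \<in> cut_rel D \<longleftrightarrow> a \<preceq> b" if "a \<in> carrier G" "b \<in> carrier G" for a b
  proof -
    have "a = b" if "b \<otimes> inv a = \<one>"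
      using that \<open>a \<in> carrier G\<close> \<open>b \<in> carrier G\<close> by (metis inv_closed inv_equality inv_inv)
    thus ?thesis using that le_iff_one_le[of a b] by (auto simp: cut_rel_def cut_cone_def inv_DirProd_integer)
  qed
  moreover have "((0, a), (1, \<one>)) \<in> cut_rel D" if "a \<in> fst D" for a
    using that cD by (auto simp: cut_rel_def cut_cone_def inv_DirProd_integer int_pow_1
        intro!: bexI[of _ a])
  moreover have "((1, \<one>), (0, b)) \<in> cut_rel D" if "b \<in> snd D" for b
    using that cD by (auto simp: cut_rel_def cut_cone_def inv_DirProd_integer int_pow_1 int_pow_neg
        intro!: bexI[of _ b])
  ultimately show ?thesis
    by (auto simp: is_cut_ext_order_def Let_def cut_ext_embed_def cut_ext_gen_def og_less_def)
qed

lemma int_pow_cut_ext: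
  assumes "d \<in> carrier G"
  shows "(k, inv d) [^]\<^bsub>with_order (integer_group \<times>\<times> G) r\<^esub> (n::nat) = (int n * k, inv (d [^] n))"
proof (induction n)
  case (Suc n)
  thus ?case using assms by (simp add: algebra_simps inv_mult m_comm)
qed simp

lemma cut_cone_pos:
  assumes D: "is_cut G D" and r: "is_cut_ext_order G D r" and x: "(n, a) \<in> cut_cone D"
  shows "((0, \<one>), (n, a)) \<in> r"
proof -
  have cD: "fst D \<subseteq> carrier G" "snd D \<subseteq> carrier G" using D by (auto simp: is_cut_def)
  define E where "E = with_order (integer_group \<times>\<times> G) r"
  have E [simp]: "carrier E = UNIV \<times> carrier G" "one E = (0, \<one>)"
    "\<And>m n a b. (m, a) \<otimes>\<^bsub>E\<^esub> (n, b) = (m + n, a \<otimes> b)" "\<And>a b. a \<preceq>\<^bsub>E\<^esub> b \<longleftrightarrow> (a, b) \<in> r"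
    by (simp_all add: E_def)
  have r': "ordered_comm_group E"
    "\<And>a b. a \<in> carrier G \<Longrightarrow> b \<in> carrier G \<Longrightarrow> ((0, a), (0, b)) \<in> r \<longleftrightarrow> a \<preceq> b"
    "\<And>a. a \<in> fst D \<Longrightarrow> ((0, a), (1, \<one>)) \<in> r"
    "\<And>b. b \<in> snd D \<Longrightarrow> ((1, \<one>), (0, b)) \<in> r"
    using r unfolding is_cut_ext_order_def Let_def E_def cut_ext_embed_def cut_ext_gen_def og_less_def
    by simp_all
  interpret E: ordered_comm_group E by (rule r'(1))
  have a: "a \<in> carrier G" using x by (auto simp: cut_cone_def)
  have key: "((0, \<one>), (n, a)) \<in> r"
    if d: "d \<in> carrier G" "\<one> \<preceq> d [^] n \<otimes> a" and k: "n = int m * k" "\<bar>k\<bar> = 1"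
      and p: "((0, \<one>), (k, d [^] (- k))) \<in> r" for d k and m :: nat
  proof -
    have "((0, \<one>), (k, d [^] (- k)) [^]\<^bsub>E\<^esub> m) \<in> r" using E.one_le_pow[of "(k, d [^] (- k))" m] p by simp
    moreover have "(k, d [^] (- k)) [^]\<^bsub>E\<^esub> m = (n, d [^] (- n))"
    proof -
      have "(k, d [^] (- k)) = (k, inv (d [^] k))" using d by (simp add: int_pow_neg)
      hence "(k, d [^] (- k)) [^]\<^bsub>E\<^esub> m = (int m * k, inv ((d [^] k) [^] m))"
        unfolding E_def using int_pow_cut_ext[of "d [^] k"] d by simp
      also have "(d [^] k) [^] m = d [^] n"
        using d k by (metis int_pow_int int_pow_pow mult.commute)
      finally show ?thesis using d k by (simp add: int_pow_neg)
    qed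
    ultimately have "((0, \<one>), (n, d [^] (- n))) \<in> r" by simp
    moreover have "((0, \<one>), (0, d [^] n \<otimes> a)) \<in> r" using r'(2) d a by simp
    ultimately have "((0, \<one>), (n, d [^] (- n)) \<otimes>\<^bsub>E\<^esub> (0, d [^] n \<otimes> a)) \<in> r"
      using E.one_le_mult[of "(n, d [^] (- n))" "(0, d [^] n \<otimes> a)"] by simp
    moreover have "d [^] (- n) \<otimes> (d [^] n \<otimes> a) = a"
      using d a by (simp add: int_pow_neg m_assoc[symmetric])
    ultimately show ?thesis by simp
  qed
  have shift: "((0, \<one>), z) \<in> r" if "(x, y) \<in> r" "y \<otimes>\<^bsub>E\<^esub> inv\<^bsub>E\<^esub> x = z" for x y z
    using E.le_iff_one_le[of x y] that E.og_le_carrier[of x y] by simp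
  have invE: "inv\<^bsub>E\<^esub> (n, a) = (- n, inv a)" if "a \<in> carrier G" for n a
    by (rule E.inv_equality) (use that in auto)
  consider "n = 0" | "n > 0" | "n < 0" by linarith
  thus ?thesis
  proof cases
    case 1
    thus ?thesis using x r'(2) a by (auto simp: cut_cone_def)
  next
    case 2
    then obtain d where d: "d \<in> fst D" "\<one> \<preceq> d [^] n \<otimes> a" using x by (auto simp: cut_cone_def)
    have cd: "d \<in> carrier G" using d cD by auto
    have "((0, \<one>), (1, d [^] (- 1 :: int))) \<in> r"
      by (rule shift[OF r'(3)[OF d(1)]]) (use cd in \<open>simp add: invE int_pow_neg int_pow_1\<close>)
    thus ?thesis using key[OF cd d(2), of "nat n" 1] 2 by simp
  next
    case 3
    then obtain d where d: "d \<in> snd D" "\<one> \<preceq> d [^] n \<otimes> a" using x by (auto simp: cut_cone_def)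
    have cd: "d \<in> carrier G" using d cD by auto
    have "((0, \<one>), (- 1, d [^] (- (- 1) :: int))) \<in> r"
      by (rule shift[OF r'(4)[OF d(1)]]) (use cd in \<open>simp add: invE int_pow_1\<close>)
    thus ?thesis using key[OF cd d(2), of "nat (- n)" "- 1"] 3 by simp
  qed
qed

lemma cut_ext_order_unique:
  assumes D: "is_cut G D" and div: "divisible_group G" and r: "is_cut_ext_order G D r"
  shows "r = cut_rel D"
proof -
  interpret E: ordered_comm_group "with_order (integer_group \<times>\<times> G) r"
    using r by (simp add: is_cut_ext_order_def Let_def)
  interpret C: ordered_comm_group "with_order (integer_group \<times>\<times> G) (cut_rel D)"
    using is_cut_ext_order_cut_rel[OF D div] by (simp add: is_cut_ext_order_def Let_def)
  have sub: "(x, y) \<in> r" if "(x, y) \<in> cut_rel D" for x y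
  proof (cases "x = y")
    case True
    thus ?thesis using E.og_refl[of x] that by (auto simp: cut_rel_def)
  next
    case False
    obtain m a n b where xy: "x = (m, a)" "y = (n, b)" by (metis surj_pair)
    have c: "a \<in> carrier G" "b \<in> carrier G" using that xy by (auto simp: cut_rel_def)
    have "(n - m, b \<otimes> inv a) \<in> cut_cone D"
      using that False xy c by (auto simp: cut_rel_def inv_DirProd_integer)
    from cut_cone_pos[OF D r this] have p: "((0, \<one>), (n - m, b \<otimes> inv a)) \<in> r" .
    from E.mult_left_mono[of "(0, \<one>)" "(n - m, b \<otimes> inv a)" "(m, a)"] p c
    show ?thesis using m_comm[of b "inv a"] m_assoc[of a "inv a" b] by (simp add: xy)
  qed
  have "(x, y) \<in> cut_rel D" if "(x, y) \<in> r" for x y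
  proof (rule ccontr)
    assume n: "(x, y) \<notin> cut_rel D"
    have "x \<in> carrier (integer_group \<times>\<times> G)" "y \<in> carrier (integer_group \<times>\<times> G)"
      using E.og_le_carrier[of x y] that by simp_all
    hence "(y, x) \<in> cut_rel D" using C.og_total[of x y] n by simp
    with sub have "(y, x) \<in> r" by blast
    hence "x = y" using E.og_antisym[of x y] that by simp
    with \<open>(y, x) \<in> cut_rel D\<close> n show False by simp
  qed
  with sub show ?thesis by auto
qed

lemma ex1_cut_ext_order:
  assumes "is_cut G D" "divisible_group G"
  shows "\<exists>!r. is_cut_ext_order G D r"
  using is_cut_ext_order_cut_rel[OF assms] cut_ext_order_unique[OF assms] by blast

lemma is_cut_ext_order_cut_ext:
  assumes "is_cut G D" "divisible_group G"
  shows "is_cut_ext_order G D (ord_rel (cut_ext G D))"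
  using theI'[OF ex1_cut_ext_order[OF assms]] by (simp add: cut_ext_def)

end

end

theory Submission
  imports Defs
begin

text \<open>Write \<open>x\<close> for the generator realizing the cut \<open>D\<close> in \<open>\<Gamma>(D)\<close>, \<open>H\<close> for the invariance group of
  \<open>D\<close>, and use additive notation. Both sides of the equivalence are statements about the distances
  \<open>|x - a|\<close> for \<open>a \<in> \<Gamma>\<close>.

  An element \<open>h\<close> of \<open>\<Gamma>\<close> is in \<open>H\<close> iff \<open>|h| < |x - a|\<close> for all \<open>a\<close>: translation by \<open>h\<close> changes the
  cut exactly if it carries some element across \<open>x\<close> (\<open>mem_invariance_group_iff_gap\<close>). And \<open>D\<close> is a
  ball cut iff some \<open>a\<close> satisfies \<open>|x - a| \<le> |g|\<close> for all \<open>g \<in> \<Gamma> - H\<close>: then \<open>x\<close> is so close to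
  \<open>a\<close> that no element of \<open>\<Gamma>\<close> outside of the coset \<open>a + H\<close> lies between \<open>a\<close> and \<open>x\<close>
  (\<open>ball_cut_iff_gap\<close>). Hence for a ball cut the absolute value of \<open>z = x - a\<close> fills the gap
  in \<open>\<Gamma>\<close> between \<open>H\<close> and the positive elements above \<open>H\<close>.

  If \<open>D\<close> is a ball cut, then \<open>z\<close> is not Archimedean equivalent to any \<open>g \<in> \<Gamma>\<close>. Indeed, for
  \<open>g \<in> H\<close> all multiples of \<open>g\<close> are in \<open>H\<close>, below \<open>|z|\<close>; for \<open>g \<notin> H\<close> all fractions of \<open>g\<close>, which exist
  by divisibility, are outside of \<open>H\<close>, above \<open>|z|\<close>. So the principal convex subgroup of \<open>z\<close> is new.
  It is the only new one: an element of \<open>\<Gamma>(D)\<close> outside \<open>\<Gamma>\<close> is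
  \<open>n x + g = n (x - b)\<close> with \<open>b = - g / n\<close>, hence equivalent to \<open>x - b = z + (a - b)\<close>, and of the two
  summands one is at most half of the other, so that the larger determines the class.

  Conversely, let a principal convex subgroup be new; as just seen it belongs to some \<open>x - a\<close>.
  Suppose that \<open>|x - a| > |g|\<close> for some \<open>g \<notin> H\<close>. As \<open>g \<notin> H\<close>, there is \<open>b\<close> with \<open>|x - b| \<le> |g|\<close>, and
  the triangle inequality makes \<open>x - a\<close> equivalent to the element \<open>|g| + |b - a|\<close> of \<open>\<Gamma>\<close>, a
  contradiction. So \<open>D\<close> is a ball cut with centre \<open>a\<close>.\<close>

section \<open>Inequalities in ordered abelian groups\<close>

context ordered_comm_group
begin

lemma mult_left_le_cancel [simp]:
  assumes "a \<in> carrier G" "b \<in> carrier G" "c \<in> carrier G"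
  shows "c \<otimes> a \<preceq> c \<otimes> b \<longleftrightarrow> a \<preceq> b"
proof
  assume "c \<otimes> a \<preceq> c \<otimes> b"
  from mult_left_mono[OF _ _ _ this, of "inv c"] show "a \<preceq> b"
    using assms by (simp add: m_assoc[symmetric])
qed (use assms mult_left_mono in blast)

lemma mult_right_le_cancel [simp]:
  assumes "a \<in> carrier G" "b \<in> carrier G" "c \<in> carrier G"
  shows "a \<otimes> c \<preceq> b \<otimes> c \<longleftrightarrow> a \<preceq> b"
  using assms by (simp add: m_comm[of _ c])

lemma mult_inv_le_iff:
  assumes "a \<in> carrier G" "b \<in> carrier G" "c \<in> carrier G"
  shows "a \<otimes> inv b \<preceq> c \<longleftrightarrow> a \<preceq> c \<otimes> b"
  using mult_right_le_cancel[of "a \<otimes> inv b" c b] assms by (simp add: m_assoc)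

lemma le_mult_inv_iff:
  assumes "a \<in> carrier G" "b \<in> carrier G" "c \<in> carrier G"
  shows "c \<preceq> a \<otimes> inv b \<longleftrightarrow> c \<otimes> b \<preceq> a"
  using mult_right_le_cancel[of c "a \<otimes> inv b" b] assms by (simp add: m_assoc)

lemma inv_le_one_iff: "a \<in> carrier G \<Longrightarrow> inv a \<preceq> \<one> \<longleftrightarrow> \<one> \<preceq> a"
  using mult_left_le_cancel[of "inv a" \<one> a] by simp

lemma one_le_inv_iff: "a \<in> carrier G \<Longrightarrow> \<one> \<preceq> inv a \<longleftrightarrow> a \<preceq> \<one>"
  using inv_le_one_iff[of "inv a"] by simp

lemma inv_anti_mono:
  assumes "a \<preceq> b"
  shows "inv b \<preceq> inv a"
  using int_pow_antimono[OF assms, of "-1"] og_le_carrier[OF assms]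
  by (simp add: int_pow_neg)

lemma og_pow_mono: "a \<preceq> b \<Longrightarrow> a [^] (n::nat) \<preceq> b [^] n"
  using int_pow_mono[of a b "int n"] by (simp add: int_pow_int)

section \<open>Absolute values\<close>

lemma og_abs_closed [simp]: "a \<in> carrier G \<Longrightarrow> og_abs G a \<in> carrier G"
  by (simp add: og_abs_def)

lemma one_le_og_abs [simp]:
  assumes "a \<in> carrier G"
  shows "\<one> \<preceq> og_abs G a"
  using og_total[OF assms one_closed] one_le_inv_iff[OF assms] by (auto simp: og_abs_def)

lemma og_abs_le_iff:
  assumes "a \<in> carrier G" "c \<in> carrier G"
  shows "og_abs G a \<preceq> c \<longleftrightarrow> a \<preceq> c \<and> inv a \<preceq> c"
proof (cases "\<one> \<preceq> a")
  case True
  hence "inv a \<preceq> a" using inv_le_one_iff[OF assms(1)] og_trans by blast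
  thus ?thesis using True og_trans by (auto simp: og_abs_def)
next
  case False
  hence "a \<preceq> \<one>" using og_total assms by blast
  hence "a \<preceq> inv a" using one_le_inv_iff[OF assms(1)] og_trans by blast
  thus ?thesis using False og_trans by (auto simp: og_abs_def)
qed

lemma le_og_abs: "a \<in> carrier G \<Longrightarrow> a \<preceq> og_abs G a"
  and inv_le_og_abs: "a \<in> carrier G \<Longrightarrow> inv a \<preceq> og_abs G a"
  using og_abs_le_iff[of a "og_abs G a"] by auto

lemma og_abs_of_one_le: "\<one> \<preceq> a \<Longrightarrow> og_abs G a = a"
  by (simp add: og_abs_def)

lemma og_abs_cases:
  assumes "a \<in> carrier G"
  obtains "og_abs G a = a" | "og_abs G a = inv a"
  using that by (cases "\<one> \<preceq> a") (simp_all add: og_abs_def)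

lemma og_abs_inv [simp]:
  assumes "a \<in> carrier G"
  shows "og_abs G (inv a) = og_abs G a"
proof (rule og_antisym)
  show "og_abs G (inv a) \<preceq> og_abs G a" "og_abs G a \<preceq> og_abs G (inv a)"
    using assms le_og_abs[of a] inv_le_og_abs[of a] le_og_abs[of "inv a"] inv_le_og_abs[of "inv a"]
    by (simp_all add: og_abs_le_iff)
qed

lemma og_abs_le_one_iff:
  assumes "a \<in> carrier G"
  shows "og_abs G a \<preceq> \<one> \<longleftrightarrow> a = \<one>"
  using assms og_abs_le_iff[of a \<one>] inv_le_one_iff[of a] og_antisym[of a \<one>] by auto

lemma og_abs_triangle:
  assumes "a \<in> carrier G" "b \<in> carrier G"
  shows "og_abs G (a \<otimes> b) \<preceq> og_abs G a \<otimes> og_abs G b"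
  using assms mult_mono[OF le_og_abs[OF assms(1)] le_og_abs[OF assms(2)]]
    mult_mono[OF inv_le_og_abs[OF assms(1)] inv_le_og_abs[OF assms(2)]]
  by (simp add: og_abs_le_iff inv_mult)

lemma og_abs_pow:
  assumes "a \<in> carrier G"
  shows "og_abs G (a [^] (n::nat)) = og_abs G a [^] n"
  using assms
proof (cases rule: og_abs_cases)
  case 1
  hence "\<one> \<preceq> a" using one_le_og_abs[OF assms] by simp
  thus ?thesis using 1 one_le_pow og_abs_of_one_le by simp
next
  case 2
  hence "\<one> \<preceq> inv a" using one_le_og_abs[OF assms] by simp
  hence "og_abs G (inv a [^] n) = inv a [^] n" using one_le_pow og_abs_of_one_le by simp
  thus ?thesis using 2 assms by (simp add: nat_pow_inv)
qed

lemma og_abs_int_pow: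
  assumes "a \<in> carrier G"
  shows "og_abs G (a [^] (n::int)) = og_abs G a [^] nat \<bar>n\<bar>"
proof (cases "n \<ge> 0")
  case True
  thus ?thesis using og_abs_pow[OF assms, of "nat n"] pow_nat[of n G a] by simp
next
  case False
  hence "a [^] n = inv (a [^] nat (- n))" using int_pow_def2[of G a n] by simp
  thus ?thesis using False og_abs_pow[OF assms, of "nat (- n)"] assms by simp
qed

lemma le_pow_self:
  assumes "\<one> \<preceq> a" "n > 0"
  shows "a \<preceq> a [^] (n::nat)"
proof -
  have c: "a \<in> carrier G" using og_le_carrier[OF assms(1)] by simp
  obtain m where m: "n = Suc m" using assms(2) gr0_implies_Suc by blast
  show ?thesis using mult_mono[OF one_le_pow[OF assms(1), of m] og_refl[OF c]] c by (simp add: m)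
qed

lemma subgroup_nat_pow_closed:
  assumes "subgroup H G" "a \<in> H"
  shows "a [^] (n::nat) \<in> H"
  using subgroup_int_pow_closed[OF assms, of "int n"] by (simp add: int_pow_int)

lemma mem_og_abs_iff:
  assumes "subgroup H G" "a \<in> carrier G"
  shows "og_abs G a \<in> H \<longleftrightarrow> a \<in> H"
  using assms(2)
proof (cases rule: og_abs_cases)
  case 2
  thus ?thesis
    using assms subgroup.m_inv_closed[OF assms(1), of a] subgroup.m_inv_closed[OF assms(1), of "inv a"]
    by auto
qed simp

section \<open>Principal convex subgroups\<close>

lemma mem_principal_convex_subgroup_if_le_pow:
  assumes "a \<in> carrier G" "b \<in> carrier G" "og_abs G b \<preceq> og_abs G a [^] (n::nat)"
  shows "b \<in> principal_convex_subgroup G a"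
  using assms by (auto simp: principal_convex_subgroup_def)

lemma mem_principal_convex_subgroup_if_le:
  assumes "a \<in> carrier G" "b \<in> carrier G" "og_abs G b \<preceq> og_abs G a"
  shows "b \<in> principal_convex_subgroup G a"
  using assms by (intro mem_principal_convex_subgroup_if_le_pow[where n = 1]) auto

lemma mem_principal_convex_subgroup_self:
  "a \<in> carrier G \<Longrightarrow> a \<in> principal_convex_subgroup G a"
  by (simp add: mem_principal_convex_subgroup_if_le)

lemma convex_principal_convex_subgroup:
  assumes a: "a \<in> carrier G"
  shows "convex_subgroup (principal_convex_subgroup G a) G"
  unfolding convex_subgroup_def
proof (intro conjI ballI impI)
  let ?P = "principal_convex_subgroup G a"
  have mem: "b \<in> ?P \<longleftrightarrow> b \<in> carrier G \<and> (\<exists>n::nat. og_abs G b \<preceq> og_abs G a [^] n)" for b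
    by (simp add: principal_convex_subgroup_def)
  show "subgroup ?P G"
  proof
    show "?P \<subseteq> carrier G" by (auto simp: mem)
    show "\<one> \<in> ?P" using a by (intro mem_principal_convex_subgroup_if_le_pow[where n = 0])
        (simp_all add: og_abs_le_one_iff)
    show "inv b \<in> ?P" if "b \<in> ?P" for b using that by (auto simp: mem)
    show "b \<otimes> c \<in> ?P" if bc: "b \<in> ?P" "c \<in> ?P" for b c
    proof -
      obtain m n :: nat where c: "b \<in> carrier G" "c \<in> carrier G"
        and "og_abs G b \<preceq> og_abs G a [^] m" "og_abs G c \<preceq> og_abs G a [^] n"
        using bc by (auto simp: mem)
      hence "og_abs G b \<otimes> og_abs G c \<preceq> og_abs G a [^] (m + n)"
        using mult_mono a by (metis nat_pow_mult og_abs_closed)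
      with og_abs_triangle[OF c] show ?thesis using c og_trans mem by blast
    qed
  qed
  fix b c d assume bc: "b \<in> ?P" "c \<in> ?P" and d: "d \<in> carrier G" "b \<preceq> d \<and> d \<preceq> c"
  then obtain m n :: nat where c: "b \<in> carrier G" "c \<in> carrier G"
    and l: "og_abs G b \<preceq> og_abs G a [^] m" "og_abs G c \<preceq> og_abs G a [^] n"
    by (auto simp: mem)
  have "d \<preceq> og_abs G c" "inv d \<preceq> og_abs G b"
    using d c le_og_abs[of c] inv_le_og_abs[of b] inv_anti_mono[of b d] og_trans by blast+
  hence 1: "d \<preceq> og_abs G a [^] n" "inv d \<preceq> og_abs G a [^] m" using l og_trans by blast+
  have 2: "og_abs G a [^] n \<preceq> og_abs G a [^] (m + n)" "og_abs G a [^] m \<preceq> og_abs G a [^] (m + n)"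
    using a mult_mono[OF og_refl one_le_pow[OF one_le_og_abs[OF a]], of "og_abs G a [^] m" n]
      mult_mono[OF one_le_pow[OF one_le_og_abs[OF a]] og_refl, of "og_abs G a [^] n" m]
    by (simp_all add: nat_pow_mult)
  have "og_abs G d \<preceq> og_abs G a [^] (m + n)"
    using og_abs_le_iff[of d "og_abs G a [^] (m + n)"] 1 2 og_trans d a by auto
  thus "d \<in> ?P" using d mem by blast
qed

text \<open>Together with \<open>convex_principal_convex_subgroup\<close> this makes \<open>H(a)\<close> the convex hull of
  \<open>a\<close>. Equalities between principal convex subgroups thus become mutual membership of generators, which
  is checked with subgroup and convexity closure instead of explicit exponents.\<close>

lemma principal_convex_subgroup_least:
  assumes K: "convex_subgroup K G" and a: "a \<in> K"
  shows "principal_convex_subgroup G a \<subseteq> K"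
proof
  fix b assume "b \<in> principal_convex_subgroup G a"
  then obtain n :: nat where b: "b \<in> carrier G" "og_abs G b \<preceq> og_abs G a [^] n"
    by (auto simp: principal_convex_subgroup_def)
  have sub: "subgroup K G" using K by (simp add: convex_subgroup_def)
  have ac: "a \<in> carrier G" using subgroup.mem_carrier[OF sub a] .
  have "og_abs G a \<in> K" using mem_og_abs_iff[OF sub ac] a by simp
  hence p: "og_abs G a [^] n \<in> K" using subgroup_nat_pow_closed[OF sub] by blast
  have "b \<preceq> og_abs G a [^] n" "inv b \<preceq> og_abs G a [^] n"
    using og_abs_le_iff[of b "og_abs G a [^] n"] b ac by auto
  moreover have "inv (og_abs G a [^] n) \<preceq> b" using inv_anti_mono[OF calculation(2)] b by simp
  ultimately show "b \<in> K"
    using K p subgroup.m_inv_closed[OF sub p] b(1) unfolding convex_subgroup_def by blast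
qed

lemma principal_convex_subgroup_eqI:
  assumes "a \<in> principal_convex_subgroup G b" "b \<in> principal_convex_subgroup G a"
  shows "principal_convex_subgroup G a = principal_convex_subgroup G b"
proof -
  have "a \<in> carrier G" "b \<in> carrier G" using assms by (auto simp: principal_convex_subgroup_def)
  thus ?thesis
    using principal_convex_subgroup_least convex_principal_convex_subgroup assms by (metis subset_antisym)
qed

lemma subgroup_principal_convex_subgroup:
  "a \<in> carrier G \<Longrightarrow> subgroup (principal_convex_subgroup G a) G"
  using convex_principal_convex_subgroup by (simp add: convex_subgroup_def)

lemma principal_convex_subgroup_int_pow:
  assumes a: "a \<in> carrier G" and n: "n \<noteq> 0"
  shows "principal_convex_subgroup G (a [^] (n::int)) = principal_convex_subgroup G a"
proof (rule principal_convex_subgroup_eqI)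
  show "a [^] n \<in> principal_convex_subgroup G a"
    using a by (intro mem_principal_convex_subgroup_if_le_pow[where n = "nat \<bar>n\<bar>"])
      (simp_all add: og_abs_int_pow)
  show "a \<in> principal_convex_subgroup G (a [^] n)"
    using a n le_pow_self[of "og_abs G a" "nat \<bar>n\<bar>"]
    by (intro mem_principal_convex_subgroup_if_le) (simp_all add: og_abs_int_pow)
qed

text \<open>An element of at most half the size cannot change the Archimedean class: \<open>2|u| \<le> |v| \<le>
  |u + v| + |u|\<close> gives \<open>|u| \<le> |u + v|\<close>, so \<open>u\<close>, and with it \<open>v\<close>, is dominated by \<open>u + v\<close>. A bound
  \<open>|u| \<le> |v|\<close> would not do, because of cancellation.\<close>

lemma principal_convex_subgroup_mult_small:
  assumes u: "u \<in> carrier G" and v: "v \<in> carrier G"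
    and small: "og_abs G u \<otimes> og_abs G u \<preceq> og_abs G v"
  shows "principal_convex_subgroup G (u \<otimes> v) = principal_convex_subgroup G v"
proof (rule principal_convex_subgroup_eqI)
  interpret V: subgroup "principal_convex_subgroup G v" G
    using subgroup_principal_convex_subgroup[OF v] .
  interpret UV: subgroup "principal_convex_subgroup G (u \<otimes> v)" G
    using subgroup_principal_convex_subgroup u v by simp
  have "og_abs G u \<preceq> og_abs G u \<otimes> og_abs G u"
    using mult_mono[OF og_refl one_le_og_abs, of "og_abs G u" u] u by simp
  hence "u \<in> principal_convex_subgroup G v"
    using u v small og_trans mem_principal_convex_subgroup_if_le by blast
  thus "u \<otimes> v \<in> principal_convex_subgroup G v"
    using mem_principal_convex_subgroup_self[OF v] by blast
  have eq: "inv u \<otimes> (u \<otimes> v) = v" using u v by (simp add: m_assoc[symmetric])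
  have "og_abs G v \<preceq> og_abs G u \<otimes> og_abs G (u \<otimes> v)"
    using og_abs_triangle[of "inv u" "u \<otimes> v"] u v by (simp add: eq)
  from og_trans[OF small this] have "og_abs G u \<preceq> og_abs G (u \<otimes> v)" using u v by simp
  hence "u \<in> principal_convex_subgroup G (u \<otimes> v)"
    using u v by (intro mem_principal_convex_subgroup_if_le) simp_all
  moreover have "u \<otimes> v \<in> principal_convex_subgroup G (u \<otimes> v)"
    using u v by (intro mem_principal_convex_subgroup_self) simp
  ultimately have "inv u \<otimes> (u \<otimes> v) \<in> principal_convex_subgroup G (u \<otimes> v)" by blast
  thus "v \<in> principal_convex_subgroup G (u \<otimes> v)" by (simp add: eq)
qed

section \<open>Cuts and their invariance groups\<close>

lemma mem_cut_cases:
  assumes "is_cut G D" "y \<in> carrier G"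
  shows "y \<in> snd D \<longleftrightarrow> y \<notin> fst D"
  using assms by (auto simp: is_cut_def og_less_def)

lemma cut_lower_closed:
  assumes D: "is_cut G D" and "b \<in> fst D" "a \<preceq> b"
  shows "a \<in> fst D"
proof -
  have "a \<in> carrier G" using assms og_le_carrier by blast
  moreover have "\<not> b \<prec> a" using assms og_antisym by (auto simp: og_less_def)
  ultimately show ?thesis using D assms(2) by (auto simp: is_cut_def)
qed

lemma mem_invariance_group_iff:
  assumes D: "is_cut G D"
  shows "h \<in> invariance_group G D \<longleftrightarrow>
    h \<in> carrier G \<and> (\<forall>y\<in>carrier G. y \<otimes> h \<in> fst D \<longleftrightarrow> y \<in> fst D)"
proof -
  have sub: "fst D \<subseteq> carrier G" using D by (auto simp: is_cut_def)
  have "fst D #> h = fst D \<longleftrightarrow> (\<forall>y\<in>carrier G. y \<otimes> h \<in> fst D \<longleftrightarrow> y \<in> fst D)" if h: "h \<in> carrier G"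
  proof
    assume eq: "fst D #> h = fst D"
    show "\<forall>y\<in>carrier G. y \<otimes> h \<in> fst D \<longleftrightarrow> y \<in> fst D"
    proof
      fix y assume y: "y \<in> carrier G"
      have "y \<otimes> h \<in> fst D #> h \<longleftrightarrow> y \<in> fst D"
        using y h sub by (auto simp: r_coset_def)
      thus "y \<otimes> h \<in> fst D \<longleftrightarrow> y \<in> fst D" using eq by simp
    qed
  next
    assume inv: "\<forall>y\<in>carrier G. y \<otimes> h \<in> fst D \<longleftrightarrow> y \<in> fst D"
    show "fst D #> h = fst D"
    proof
      show "fst D #> h \<subseteq> fst D" using inv sub by (auto simp: r_coset_def)
      show "fst D \<subseteq> fst D #> h"
      proof
        fix z assume z: "z \<in> fst D"
        hence zc: "z \<in> carrier G" using sub by blast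
        have e: "(z \<otimes> inv h) \<otimes> h = z" using zc h by (simp add: m_assoc)
        hence "z \<otimes> inv h \<in> fst D" using inv z zc h by (metis inv_closed m_closed)
        thus "z \<in> fst D #> h" using e by (force simp: r_coset_def)
      qed
    qed
  qed
  thus ?thesis by (auto simp: invariance_group_def)
qed

lemma convex_subgroup_invariance_group:
  assumes D: "is_cut G D"
  shows "convex_subgroup (invariance_group G D) G"
  unfolding convex_subgroup_def
proof (intro conjI ballI impI)
  let ?H = "invariance_group G D"
  note mem = mem_invariance_group_iff[OF D]
  show "subgroup ?H G"
  proof
    show "?H \<subseteq> carrier G" by (auto simp: mem)
    show "\<one> \<in> ?H" by (simp add: mem)
    show "h \<otimes> k \<in> ?H" if "h \<in> ?H" "k \<in> ?H" for h k
      using that by (simp add: mem m_assoc[symmetric])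
    show "inv h \<in> ?H" if h: "h \<in> ?H" for h
    proof -
      have hc: "h \<in> carrier G" using h mem by blast
      have "y \<otimes> inv h \<in> fst D \<longleftrightarrow> y \<in> fst D" if y: "y \<in> carrier G" for y
      proof -
        have "(y \<otimes> inv h) \<otimes> h \<in> fst D \<longleftrightarrow> y \<otimes> inv h \<in> fst D" using h y hc mem by simp
        thus ?thesis using y hc by (simp add: m_assoc)
      qed
      thus ?thesis using hc mem by simp
    qed
  qed
  fix h k c assume hk: "h \<in> ?H" "k \<in> ?H" and c: "c \<in> carrier G" "h \<preceq> c \<and> c \<preceq> k"
  have hkc: "h \<in> carrier G" "k \<in> carrier G" using hk mem by auto
  have "y \<otimes> c \<in> fst D \<longleftrightarrow> y \<in> fst D" if y: "y \<in> carrier G" for y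
  proof
    assume "y \<otimes> c \<in> fst D"
    hence "y \<otimes> h \<in> fst D" using cut_lower_closed[OF D] c y hkc by simp
    thus "y \<in> fst D" using hk mem y by simp
  next
    assume "y \<in> fst D"
    hence "y \<otimes> k \<in> fst D" using hk mem y by simp
    thus "y \<otimes> c \<in> fst D" using cut_lower_closed[OF D] c y hkc by simp
  qed
  thus "c \<in> ?H" using c mem by simp
qed

section \<open>Ball cuts described in the group itself\<close>

lemma mem_r_coset_iff: "b \<in> H #> a \<longleftrightarrow> (\<exists>h\<in>H. b = h \<otimes> a)"
  by (auto simp: r_coset_def)

lemma r_coset_eq_iff:
  assumes "subgroup H G" "a \<in> carrier G" "b \<in> carrier G"
  shows "H #> a = H #> b \<longleftrightarrow> (\<exists>h\<in>H. a = h \<otimes> b)"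
  using repr_independence[of a H b] rcos_self[of a H] assms mem_r_coset_iff[of a H b]
  by (metis)

lemma carrier_quotient_og: "carrier (quotient_og G H) = (\<lambda>a. H #> a) ` carrier G"
  by (auto simp: quotient_og_def FactGroup_def RCOSETS_def)

lemma quotient_og_le_iff:
  assumes H: "subgroup H G" and a: "a \<in> carrier G" and b: "b \<in> carrier G"
  shows "(H #> a) \<preceq>\<^bsub>quotient_og G H\<^esub> (H #> b) \<longleftrightarrow> (\<exists>h\<in>H. a \<preceq> h \<otimes> b)"
proof -
  have Hc: "H \<subseteq> carrier G" using subgroup.subset[OF H] .
  have "(H #> a) \<preceq>\<^bsub>quotient_og G H\<^esub> (H #> b) \<longleftrightarrow> (\<exists>a'\<in>H #> a. \<exists>b'\<in>H #> b. a' \<preceq> b')"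
    using a b by (auto simp: quotient_og_def FactGroup_def RCOSETS_def)
  also have "\<dots> \<longleftrightarrow> (\<exists>h\<in>H. a \<preceq> h \<otimes> b)"
  proof
    assume "\<exists>a'\<in>H #> a. \<exists>b'\<in>H #> b. a' \<preceq> b'"
    then obtain h k where h: "h \<in> H" "k \<in> H" and le: "h \<otimes> a \<preceq> k \<otimes> b"
      by (auto simp: mem_r_coset_iff)
    have hc: "h \<in> carrier G" "k \<in> carrier G" using h Hc by auto
    have "inv h \<otimes> (h \<otimes> a) \<preceq> inv h \<otimes> (k \<otimes> b)"
      using mult_left_mono[OF _ _ _ le] a b hc by simp
    hence "a \<preceq> (inv h \<otimes> k) \<otimes> b" using a b hc by (simp add: m_assoc[symmetric])
    moreover have "inv h \<otimes> k \<in> H" using H h by (simp add: subgroup.m_closed subgroup.m_inv_closed)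
    ultimately show "\<exists>h\<in>H. a \<preceq> h \<otimes> b" by blast
  next
    assume "\<exists>h\<in>H. a \<preceq> h \<otimes> b"
    then obtain h where "h \<otimes> b \<in> H #> b" "a \<preceq> h \<otimes> b" by (auto simp: mem_r_coset_iff)
    thus "\<exists>a'\<in>H #> a. \<exists>b'\<in>H #> b. a' \<preceq> b'" using rcos_self[OF a H] by blast
  qed
  finally show ?thesis .
qed

text \<open>Convexity is what makes the comparison of cosets by representatives antisymmetric: the two
  inequalities enclose \<open>a - b\<close> between elements of \<open>H\<close>.\<close>

lemma quotient_og_antisym:
  assumes H: "convex_subgroup H G" and a: "a \<in> carrier G" and b: "b \<in> carrier G"
    and le: "(H #> a) \<preceq>\<^bsub>quotient_og G H\<^esub> (H #> b)" "(H #> b) \<preceq>\<^bsub>quotient_og G H\<^esub> (H #> a)"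
  shows "H #> a = H #> b"
proof -
  have sub: "subgroup H G" using H by (simp add: convex_subgroup_def)
  obtain h k where h: "h \<in> H" "a \<preceq> h \<otimes> b" and k: "k \<in> H" "b \<preceq> k \<otimes> a"
    using le unfolding quotient_og_le_iff[OF sub a b] quotient_og_le_iff[OF sub b a] by blast
  have c: "h \<in> carrier G" "k \<in> carrier G" using h k subgroup.mem_carrier[OF sub] by auto
  have "a \<otimes> inv b \<preceq> h" using mult_inv_le_iff a b c h by simp
  moreover have "b \<otimes> inv a \<preceq> k" using mult_inv_le_iff a b c k by simp
  hence "inv k \<preceq> a \<otimes> inv b"
    using inv_anti_mono[of "b \<otimes> inv a" k] a b by (simp add: inv_mult m_comm)
  ultimately have "a \<otimes> inv b \<in> H"
    using H h(1) subgroup.m_inv_closed[OF sub k(1)] a b unfolding convex_subgroup_def by blast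
  moreover have "a = (a \<otimes> inv b) \<otimes> b" using a b by (simp add: m_assoc)
  ultimately show ?thesis using r_coset_eq_iff[OF sub a b] by blast
qed

text \<open>As \<open>D\<close> is a union of cosets of its invariance group, its image in the quotient is always a
  cut, and a coset lies in the image of \<open>fst D\<close> or \<open>snd D\<close> iff its representatives lie in \<open>fst D\<close> or
  \<open>snd D\<close>. So being principal can be stated with elements only. One of the two sides of the cut
  determines the other, and it is chosen to be the one that contains the coset of \<open>a\<close>.\<close>

lemma ball_cut_iff:
  assumes D: "is_cut G D"
  defines "H \<equiv> invariance_group G D"
  shows "ball_cut G D \<longleftrightarrow> (\<exists>a\<in>carrier G.
    (\<forall>y\<in>carrier G. y \<in> fst D \<longleftrightarrow> (\<exists>h\<in>H. y \<preceq> h \<otimes> a)) \<or>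
    (\<forall>y\<in>carrier G. y \<in> snd D \<longleftrightarrow> (\<exists>h\<in>H. a \<preceq> h \<otimes> y)))"
proof -
  define Q where "Q = quotient_og G H"
  define C where "C = cut_image G H D"
  have conv: "convex_subgroup H G" using convex_subgroup_invariance_group[OF D] by (simp add: H_def)
  hence sub: "subgroup H G" by (simp add: convex_subgroup_def)
  have Dc: "fst D \<subseteq> carrier G" "snd D \<subseteq> carrier G" "carrier G \<subseteq> fst D \<union> snd D"
    using D by (auto simp: is_cut_def)
  have Q: "carrier Q = (\<lambda>a. H #> a) ` carrier G"
    unfolding Q_def by (rule carrier_quotient_og)
  have C: "fst C = (\<lambda>a. H #> a) ` fst D" "snd C = (\<lambda>a. H #> a) ` snd D"
    by (simp_all add: C_def cut_image_def)
  have invar: "h \<otimes> y \<in> fst D \<longleftrightarrow> y \<in> fst D" if "h \<in> H" "y \<in> carrier G" for h y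
    using that mem_invariance_group_iff[OF D, of h] unfolding H_def by (auto simp: m_comm[of h y])
  have memL: "H #> y \<in> fst C \<longleftrightarrow> y \<in> fst D" if y: "y \<in> carrier G" for y
  proof
    assume "H #> y \<in> fst C"
    then obtain z where z: "z \<in> fst D" "H #> y = H #> z" by (auto simp: C)
    hence zc: "z \<in> carrier G" using Dc(1) by blast
    then obtain h where "h \<in> H" "y = h \<otimes> z" using z(2) r_coset_eq_iff[OF sub y] by blast
    thus "y \<in> fst D" using invar z(1) zc by simp
  qed (simp add: C)
  have memR: "H #> y \<in> snd C \<longleftrightarrow> y \<in> snd D" if y: "y \<in> carrier G" for y
  proof
    assume "H #> y \<in> snd C"
    then obtain z where z: "z \<in> snd D" "H #> z = H #> y" by (auto simp: C)
    hence zc: "z \<in> carrier G" using Dc(2) by blast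
    hence "H #> z \<notin> fst C" using memL z(1) mem_cut_cases[OF D zc] by simp
    thus "y \<in> snd D" using memL[OF y] z(2) mem_cut_cases[OF D y] by simp
  qed (simp add: C)
  have less: "(H #> a) \<prec>\<^bsub>Q\<^esub> (H #> b)" if "a \<in> fst D" "b \<in> snd D" for a b
  proof -
    have c: "a \<in> carrier G" "b \<in> carrier G" using that Dc by auto
    have "a \<preceq> \<one> \<otimes> b" using that D c by (auto simp: is_cut_def og_less_def)
    hence "(H #> a) \<preceq>\<^bsub>Q\<^esub> (H #> b)"
      unfolding Q_def quotient_og_le_iff[OF sub c] using subgroup.one_closed[OF sub] by blast
    moreover have "H #> a \<noteq> H #> b"
      using that memL[OF c(1)] memL[OF c(2)] mem_cut_cases[OF D c(2)] by auto
    ultimately show ?thesis by (simp add: og_less_def)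
  qed
  have cutC: "is_cut Q C"
    unfolding is_cut_def using less D by (auto simp: Q C is_cut_def)
  have above: "C = cut_above Q (H #> a) \<longleftrightarrow> (\<forall>y\<in>carrier G. y \<in> fst D \<longleftrightarrow> (\<exists>h\<in>H. y \<preceq> h \<otimes> a))"
    (is "_ \<longleftrightarrow> ?R") if a: "a \<in> carrier G" for a
  proof
    assume "C = cut_above Q (H #> a)"
    hence "H #> y \<in> fst C \<longleftrightarrow> (H #> y) \<preceq>\<^bsub>Q\<^esub> (H #> a)" if "y \<in> carrier G" for y
      using that by (auto simp: cut_above_def Q)
    thus ?R by (simp add: memL quotient_og_le_iff[OF sub _ a] Q_def)
  next
    assume R: ?R
    have le: "(H #> y) \<preceq>\<^bsub>Q\<^esub> (H #> a) \<longleftrightarrow> y \<in> fst D" if "y \<in> carrier G" for y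
      using R that by (simp add: quotient_og_le_iff[OF sub that a] Q_def)
    have aL: "a \<in> fst D" using R a subgroup.one_closed[OF sub] by (auto intro!: bexI[of _ \<one>])
    have gt: "(H #> a) \<prec>\<^bsub>Q\<^esub> (H #> y) \<longleftrightarrow> y \<in> snd D" if y: "y \<in> carrier G" for y
    proof
      assume lt: "(H #> a) \<prec>\<^bsub>Q\<^esub> (H #> y)"
      have "\<not> (H #> y) \<preceq>\<^bsub>Q\<^esub> (H #> a)"
        using lt quotient_og_antisym[OF conv a y] unfolding Q_def og_less_def by blast
      thus "y \<in> snd D" using le y mem_cut_cases[OF D] by blast
    qed (use less aL in blast)
    have "fst C = {X \<in> carrier Q. X \<preceq>\<^bsub>Q\<^esub> (H #> a)}" using le Dc(1) by (auto simp: C Q)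
    moreover have "snd C = {X \<in> carrier Q. (H #> a) \<prec>\<^bsub>Q\<^esub> X}" using gt Dc(2) by (auto simp: C Q)
    ultimately show "C = cut_above Q (H #> a)" by (simp add: cut_above_def prod_eq_iff)
  qed
  have below: "C = cut_below Q (H #> a) \<longleftrightarrow> (\<forall>y\<in>carrier G. y \<in> snd D \<longleftrightarrow> (\<exists>h\<in>H. a \<preceq> h \<otimes> y))"
    (is "_ \<longleftrightarrow> ?R") if a: "a \<in> carrier G" for a
  proof
    assume "C = cut_below Q (H #> a)"
    hence "H #> y \<in> snd C \<longleftrightarrow> (H #> a) \<preceq>\<^bsub>Q\<^esub> (H #> y)" if "y \<in> carrier G" for y
      using that by (auto simp: cut_below_def Q)
    thus ?R by (simp add: memR quotient_og_le_iff[OF sub a] Q_def)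
  next
    assume R: ?R
    have le: "(H #> a) \<preceq>\<^bsub>Q\<^esub> (H #> y) \<longleftrightarrow> y \<in> snd D" if "y \<in> carrier G" for y
      using R that by (simp add: quotient_og_le_iff[OF sub a that] Q_def)
    have aR: "a \<in> snd D" using R a subgroup.one_closed[OF sub] by (auto intro!: bexI[of _ \<one>])
    have lt: "(H #> y) \<prec>\<^bsub>Q\<^esub> (H #> a) \<longleftrightarrow> y \<in> fst D" if y: "y \<in> carrier G" for y
    proof
      assume lt: "(H #> y) \<prec>\<^bsub>Q\<^esub> (H #> a)"
      have "\<not> (H #> a) \<preceq>\<^bsub>Q\<^esub> (H #> y)"
        using lt quotient_og_antisym[OF conv y a] unfolding Q_def og_less_def by blast
      thus "y \<in> fst D" using le y mem_cut_cases[OF D] by blast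
    qed (use less aR in blast)
    have "snd C = {X \<in> carrier Q. (H #> a) \<preceq>\<^bsub>Q\<^esub> X}" using le Dc(2) by (auto simp: C Q)
    moreover have "fst C = {X \<in> carrier Q. X \<prec>\<^bsub>Q\<^esub> (H #> a)}" using lt Dc(1) by (auto simp: C Q)
    ultimately show "C = cut_below Q (H #> a)" by (simp add: cut_below_def prod_eq_iff)
  qed
  have "ball_cut G D \<longleftrightarrow> principal_cut Q C"
    by (simp add: ball_cut_def Q_def C_def H_def)
  also have "\<dots> \<longleftrightarrow> (\<exists>a\<in>carrier G. C = cut_above Q (H #> a) \<or> C = cut_below Q (H #> a))"
    using cutC by (simp add: principal_cut_def Q)
  finally show ?thesis using above below by simp
qed

end

section \<open>Ordered extensions and new principal convex subgroups\<close>

text \<open>The argument only needs an order embedding of \<open>G\<close> into \<open>L\<close> and an element \<open>x\<close> of \<open>L\<close>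
  that realizes the cut. Working with these instead of the pairs that make up \<open>\<Gamma>(D)\<close> keeps the
  construction of its order out of the proof.\<close>

locale ordered_extension = G: ordered_comm_group G + L: ordered_comm_group L
  for G :: "('a, 'c) ordered_group_scheme" (structure)
    and L :: "('b, 'd) ordered_group_scheme" (structure)
    and \<iota> :: "'a \<Rightarrow> 'b" +
  assumes embed_hom: "\<iota> \<in> hom G L"
    and embed_le_iff [simp]:
      "a \<in> carrier G \<Longrightarrow> b \<in> carrier G \<Longrightarrow> \<iota> a \<preceq>\<^bsub>L\<^esub> \<iota> b \<longleftrightarrow> a \<preceq> b"
begin

lemma group_hom_embed: "group_hom G L \<iota>"
  by unfold_locales (rule embed_hom)

sublocale embed: group_hom G L \<iota>
  by (rule group_hom_embed)

lemma embed_abs [simp]: "a \<in> carrier G \<Longrightarrow> og_abs L (\<iota> a) = \<iota> (og_abs G a)"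
  using embed_le_iff[of "\<one>" a] by (simp add: og_abs_def del: embed_le_iff)

text \<open>The convex hull of the image of \<open>H(g)\<close> is again principal, with generator \<open>\<iota> g\<close>. Whether the
  rank increases is thus a matter of the classes of elements of \<open>L\<close> and of \<open>\<iota> ` carrier G\<close>.\<close>

lemma Prin_map_principal:
  assumes g: "g \<in> carrier G"
  shows "Prin_map L \<iota> (principal_convex_subgroup G g) = principal_convex_subgroup L (\<iota> g)"
  unfolding Prin_map_def convex_hull_subgroup_def
proof
  have "\<iota> b \<in> principal_convex_subgroup L (\<iota> g)" if b: "b \<in> principal_convex_subgroup G g" for b
  proof -
    obtain n :: nat where n: "b \<in> carrier G" "og_abs G b \<preceq> og_abs G g [^] n"
      using b by (auto simp: principal_convex_subgroup_def)
    thus ?thesis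
      using g embed_le_iff[of "og_abs G b" "og_abs G g [^] n"]
      by (intro L.mem_principal_convex_subgroup_if_le_pow[where n = n]) (simp_all add: embed.hom_nat_pow)
  qed
  thus "\<Inter> {K. convex_subgroup K L \<and> \<iota> ` principal_convex_subgroup G g \<subseteq> K}
      \<subseteq> principal_convex_subgroup L (\<iota> g)"
    using L.convex_principal_convex_subgroup[of "\<iota> g"] g by auto
  show "principal_convex_subgroup L (\<iota> g)
      \<subseteq> \<Inter> {K. convex_subgroup K L \<and> \<iota> ` principal_convex_subgroup G g \<subseteq> K}"
    using L.principal_convex_subgroup_least G.mem_principal_convex_subgroup_self[OF g] by blast
qed

lemma mem_new_Prin_iff:
  "K \<in> Prin L - Prin_map L \<iota> ` Prin G \<longleftrightarrow>
    (\<exists>w\<in>carrier L - {\<one>\<^bsub>L\<^esub>}. K = principal_convex_subgroup L w \<and>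
      (\<forall>g\<in>carrier G - {\<one>}. K \<noteq> principal_convex_subgroup L (\<iota> g)))"
proof -
  have eq: "Prin_map L \<iota> ` Prin G = (\<lambda>g. principal_convex_subgroup L (\<iota> g)) ` (carrier G - {\<one>})"
    unfolding Prin_def image_image using Prin_map_principal by (intro image_cong) auto
  show ?thesis unfolding eq by (auto simp: Prin_def)
qed

end

section \<open>The distance from a cut to the elements of the group\<close>

locale cut_realization = ordered_extension G L \<iota>
  for G :: "('a, 'c) ordered_group_scheme" (structure)
    and L :: "('b, 'd) ordered_group_scheme" (structure)
    and \<iota> :: "'a \<Rightarrow> 'b" +
  fixes D :: "'a set \<times> 'a set" and x :: 'b
  assumes cut: "is_cut G D"
    and lower: "a \<in> fst D \<Longrightarrow> \<iota> a \<prec>\<^bsub>L\<^esub> x"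
    and upper: "b \<in> snd D \<Longrightarrow> x \<prec>\<^bsub>L\<^esub> \<iota> b"
    and x_closed [simp]: "x \<in> carrier L"
begin

abbreviation "H \<equiv> invariance_group G D"

definition gap :: "'a \<Rightarrow> 'b"
  where "gap a = x \<otimes>\<^bsub>L\<^esub> inv\<^bsub>L\<^esub> \<iota> a"

lemma gap_closed [simp]: "a \<in> carrier G \<Longrightarrow> gap a \<in> carrier L"
  by (simp add: gap_def)

lemma mem_lower_iff: "a \<in> carrier G \<Longrightarrow> a \<in> fst D \<longleftrightarrow> \<iota> a \<preceq>\<^bsub>L\<^esub> x"
  using lower[of a] upper[of a] L.og_antisym[of "\<iota> a" x] G.mem_cut_cases[OF cut, of a]
  by (auto simp: og_less_def)

lemma mem_upper_iff: "a \<in> carrier G \<Longrightarrow> a \<in> snd D \<longleftrightarrow> x \<preceq>\<^bsub>L\<^esub> \<iota> a"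
  using lower[of a] upper[of a] L.og_antisym[of "\<iota> a" x] G.mem_cut_cases[OF cut, of a]
  by (auto simp: og_less_def)

lemma gap_le_iff:
  assumes "a \<in> carrier G" "k \<in> carrier G"
  shows "gap a \<preceq>\<^bsub>L\<^esub> \<iota> k \<longleftrightarrow> k \<otimes> a \<in> snd D"
  using assms by (simp add: gap_def L.mult_inv_le_iff mem_upper_iff)

lemma inv_gap_le_iff:
  assumes "a \<in> carrier G" "k \<in> carrier G"
  shows "inv\<^bsub>L\<^esub> gap a \<preceq>\<^bsub>L\<^esub> \<iota> k \<longleftrightarrow> inv k \<otimes> a \<in> fst D"
proof -
  have "inv\<^bsub>L\<^esub> gap a = \<iota> a \<otimes>\<^bsub>L\<^esub> inv\<^bsub>L\<^esub> x"
    using assms by (simp add: gap_def L.inv_mult L.m_comm)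
  hence "inv\<^bsub>L\<^esub> gap a \<preceq>\<^bsub>L\<^esub> \<iota> k \<longleftrightarrow> \<iota> a \<preceq>\<^bsub>L\<^esub> \<iota> k \<otimes>\<^bsub>L\<^esub> x"
    using assms by (simp add: L.mult_inv_le_iff)
  also have "\<dots> \<longleftrightarrow> \<iota> (inv k \<otimes> a) \<preceq>\<^bsub>L\<^esub> x"
    using assms L.mult_inv_le_iff[of "\<iota> a" "\<iota> k" x] by (simp add: L.m_comm)
  also have "\<dots> \<longleftrightarrow> inv k \<otimes> a \<in> fst D" using assms mem_lower_iff by simp
  finally show ?thesis .
qed

text \<open>Distances from \<open>x\<close> to elements of \<open>G\<close>, measured by elements of \<open>G\<close>, are read off from the cut:
  \<open>|x - a| \<le> k\<close> says that \<open>x\<close> lies between \<open>a - k\<close> and \<open>a + k\<close>.\<close>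

lemma abs_gap_le_iff:
  assumes "a \<in> carrier G" "k \<in> carrier G"
  shows "og_abs L (gap a) \<preceq>\<^bsub>L\<^esub> \<iota> k \<longleftrightarrow> k \<otimes> a \<in> snd D \<and> inv k \<otimes> a \<in> fst D"
  using assms by (simp add: L.og_abs_le_iff gap_le_iff inv_gap_le_iff)

text \<open>If \<open>|x - a| \<le> k\<close>, then \<open>a - k\<close> and \<open>a + k\<close> are on different sides of the cut, so \<open>2k\<close>
  and hence \<open>k\<close> does not preserve it. If \<open>k \<ge> 0\<close> does not preserve the cut, some \<open>y\<close> has
  \<open>y < x < y + k\<close>, and \<open>|x - y| \<le> k\<close>.\<close>

lemma mem_invariance_group_iff_gap:
  assumes h: "h \<in> carrier G"
  shows "h \<in> H \<longleftrightarrow> (\<forall>a\<in>carrier G. \<not> og_abs L (gap a) \<preceq>\<^bsub>L\<^esub> \<iota> (og_abs G h))"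
proof -
  define k where "k = og_abs G h"
  have sub: "subgroup H G"
    using G.convex_subgroup_invariance_group[OF cut] by (simp add: convex_subgroup_def)
  have k: "k \<in> carrier G" "\<one> \<preceq> k" "h \<in> H \<longleftrightarrow> k \<in> H"
    using h G.mem_og_abs_iff[OF sub h] by (simp_all add: k_def)
  note mem = G.mem_invariance_group_iff[OF cut]
  have "\<not> (k \<otimes> a \<in> snd D \<and> inv k \<otimes> a \<in> fst D)" if kH: "k \<in> H" and a: "a \<in> carrier G" for a
  proof -
    have "inv k \<in> H" using subgroup.m_inv_closed[OF sub kH] .
    hence "k \<otimes> a \<in> fst D \<longleftrightarrow> a \<in> fst D" "inv k \<otimes> a \<in> fst D \<longleftrightarrow> a \<in> fst D"
      using kH a k(1) mem by (simp_all add: G.m_comm[of _ a])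
    thus ?thesis using G.mem_cut_cases[OF cut, of "k \<otimes> a"] a k by auto
  qed
  moreover have "\<exists>a\<in>carrier G. k \<otimes> a \<in> snd D \<and> inv k \<otimes> a \<in> fst D" if kH: "k \<notin> H"
  proof -
    obtain y where y: "y \<in> carrier G" "\<not> (y \<otimes> k \<in> fst D \<longleftrightarrow> y \<in> fst D)"
      using kH k mem by blast
    have yk: "y \<preceq> y \<otimes> k" "inv k \<otimes> y \<preceq> y"
      using y k G.mult_mono[of y y \<one> k] G.mult_mono[of "inv k" \<one> y y]
      by (simp_all add: G.inv_le_one_iff)
    have "y \<in> fst D" "y \<otimes> k \<notin> fst D" using y G.cut_lower_closed[OF cut _ yk(1)] by auto
    moreover from this have "inv k \<otimes> y \<in> fst D" using G.cut_lower_closed[OF cut _ yk(2)] by simp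
    ultimately show ?thesis
      using y(1) k G.mem_cut_cases[OF cut, of "y \<otimes> k"] G.m_comm[of k y]
      by (intro bexI[of _ y]) auto
  qed
  ultimately have "k \<in> H \<longleftrightarrow> (\<forall>a\<in>carrier G. \<not> (k \<otimes> a \<in> snd D \<and> inv k \<otimes> a \<in> fst D))"
    by blast
  thus ?thesis using k(1,3) by (simp add: abs_gap_le_iff k_def[symmetric])
qed

text \<open>If the cut lies immediately above the coset \<open>a + H\<close> and \<open>k > 0\<close> is not in \<open>H\<close>, then \<open>a + k\<close> is
  beyond that coset, so \<open>a < x < a + k\<close>. Conversely, if \<open>x\<close> is above \<open>a\<close> and no farther from
  it than any element outside of \<open>H\<close>, then every \<open>y\<close> with \<open>a \<le> y < x\<close> satisfies \<open>y - a < x - a\<close>,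
  so \<open>y - a \<in> H\<close> and the cut is immediately above \<open>a + H\<close>. The case of a cut below the coset
  is symmetric.\<close>

lemma ball_cut_iff_gap:
  "ball_cut G D \<longleftrightarrow>
    (\<exists>a\<in>carrier G. \<forall>g\<in>carrier G - H. og_abs L (gap a) \<preceq>\<^bsub>L\<^esub> \<iota> (og_abs G g))"
proof -
  have conv: "convex_subgroup H G" using G.convex_subgroup_invariance_group[OF cut] .
  hence sub: "subgroup H G" by (simp add: convex_subgroup_def)
  have Hc: "h \<in> carrier G" if "h \<in> H" for h using that subgroup.mem_carrier[OF sub] by blast
  have invar: "h \<otimes> y \<in> fst D \<longleftrightarrow> y \<in> fst D" if "h \<in> H" "y \<in> carrier G" for h y
    using that G.mem_invariance_group_iff[OF cut, of h] by (auto simp: G.m_comm[of h y])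
  have between: "k \<in> H" if "h \<in> H" "\<one> \<preceq> k" "k \<preceq> h" for h k
    using conv that subgroup.one_closed[OF sub] G.og_le_carrier[OF that(2)]
    unfolding convex_subgroup_def by blast
  have "(\<forall>y\<in>carrier G. y \<in> fst D \<longleftrightarrow> (\<exists>h\<in>H. y \<preceq> h \<otimes> a)) \<or>
        (\<forall>y\<in>carrier G. y \<in> snd D \<longleftrightarrow> (\<exists>h\<in>H. a \<preceq> h \<otimes> y)) \<longleftrightarrow>
      (\<forall>g\<in>carrier G - H. og_abs L (gap a) \<preceq>\<^bsub>L\<^esub> \<iota> (og_abs G g))"
    (is "?A \<or> ?B \<longleftrightarrow> ?R") if a: "a \<in> carrier G" for a
  proof
    assume AB: "?A \<or> ?B"
    show ?R
    proof
      fix g assume g: "g \<in> carrier G - H"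
      define k where "k = og_abs G g"
      have k: "k \<in> carrier G" "\<one> \<preceq> k" "k \<notin> H"
        using g G.mem_og_abs_iff[OF sub, of g] by (auto simp: k_def)
      have ka: "a \<preceq> k \<otimes> a" "inv k \<otimes> a \<preceq> a"
        using a k G.mult_mono[of \<one> k a a] G.mult_mono[of "inv k" \<one> a a]
        by (simp_all add: G.inv_le_one_iff)
      from AB have "k \<otimes> a \<in> snd D \<and> inv k \<otimes> a \<in> fst D"
      proof
        assume A: ?A
        have "a \<in> fst D" using A a subgroup.one_closed[OF sub] by (auto intro!: bexI[of _ \<one>])
        hence "inv k \<otimes> a \<in> fst D" using G.cut_lower_closed[OF cut _ ka(2)] by simp
        moreover have "k \<otimes> a \<notin> fst D"
        proof
          assume "k \<otimes> a \<in> fst D"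
          then obtain h where h: "h \<in> H" "k \<otimes> a \<preceq> h \<otimes> a" using A a k by auto
          hence "k \<preceq> h" using a k Hc by simp
          thus False using between h k by blast
        qed
        ultimately show ?thesis using G.mem_cut_cases[OF cut, of "k \<otimes> a"] a k by simp
      next
        assume B: ?B
        have "a \<in> snd D" using B a subgroup.one_closed[OF sub] by (auto intro!: bexI[of _ \<one>])
        hence "a \<notin> fst D" using G.mem_cut_cases[OF cut a] by simp
        hence "k \<otimes> a \<notin> fst D" using G.cut_lower_closed[OF cut _ ka(1)] by blast
        moreover have "inv k \<otimes> a \<notin> snd D"
        proof
          assume "inv k \<otimes> a \<in> snd D"
          then obtain h where h: "h \<in> H" "a \<preceq> h \<otimes> (inv k \<otimes> a)" using B a k by auto
          have "h \<otimes> (inv k \<otimes> a) = (h \<otimes> inv k) \<otimes> a" using h Hc a k by (simp add: G.m_assoc)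
          hence "\<one> \<preceq> h \<otimes> inv k"
            using G.mult_right_le_cancel[of \<one> "h \<otimes> inv k" a] h(2) Hc[OF h(1)] a k by simp
          hence "k \<preceq> h" using k h Hc by (simp add: G.le_mult_inv_iff)
          thus False using between h k by blast
        qed
        ultimately show ?thesis
          using G.mem_cut_cases[OF cut, of "k \<otimes> a"] G.mem_cut_cases[OF cut, of "inv k \<otimes> a"] a k
          by simp
      qed
      thus "og_abs L (gap a) \<preceq>\<^bsub>L\<^esub> \<iota> (og_abs G g)"
        using a k(1) by (simp add: abs_gap_le_iff k_def)
    qed
  next
    assume R: ?R
    have inH: "g \<in> H" if "g \<in> carrier G" "\<one> \<preceq> g" "\<not> (g \<otimes> a \<in> snd D \<and> inv g \<otimes> a \<in> fst D)" for g
    proof (rule ccontr)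
      assume "g \<notin> H"
      hence "og_abs L (gap a) \<preceq>\<^bsub>L\<^esub> \<iota> (og_abs G g)" using R that by blast
      thus False using that a by (simp add: G.og_abs_of_one_le abs_gap_le_iff)
    qed
    show "?A \<or> ?B"
    proof (cases "a \<in> fst D")
      case True
      have "y \<in> fst D \<longleftrightarrow> (\<exists>h\<in>H. y \<preceq> h \<otimes> a)" if y: "y \<in> carrier G" for y
      proof
        assume yL: "y \<in> fst D"
        show "\<exists>h\<in>H. y \<preceq> h \<otimes> a"
        proof (cases "y \<preceq> a")
          case True
          thus ?thesis using a subgroup.one_closed[OF sub] by (intro bexI[of _ \<one>]) auto
        next
          case False
          hence "a \<preceq> y" using G.og_total a y by blast
          hence 1: "\<one> \<preceq> y \<otimes> inv a" using G.le_iff_one_le a y by blast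
          have e: "(y \<otimes> inv a) \<otimes> a = y" using a y by (simp add: G.m_assoc)
          have "y \<otimes> inv a \<in> H"
            using inH[OF _ 1] e yL G.mem_cut_cases[OF cut y] a y by simp
          thus ?thesis using e y by (intro bexI[of _ "y \<otimes> inv a"]) simp_all
        qed
      next
        assume "\<exists>h\<in>H. y \<preceq> h \<otimes> a"
        thus "y \<in> fst D" using invar[OF _ a] True G.cut_lower_closed[OF cut] by blast
      qed
      thus ?thesis by blast
    next
      case False
      have "y \<in> snd D \<longleftrightarrow> (\<exists>h\<in>H. a \<preceq> h \<otimes> y)" if y: "y \<in> carrier G" for y
      proof
        assume yR: "y \<in> snd D"
        show "\<exists>h\<in>H. a \<preceq> h \<otimes> y"
        proof (cases "a \<preceq> y")
          case True
          thus ?thesis using y subgroup.one_closed[OF sub] by (intro bexI[of _ \<one>]) auto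
        next
          case F: False
          hence "y \<preceq> a" using G.og_total a y by blast
          hence 1: "\<one> \<preceq> a \<otimes> inv y" using G.le_iff_one_le a y by blast
          have e: "inv (a \<otimes> inv y) \<otimes> a = y"
            using a y by (simp add: G.inv_mult G.m_comm[of _ y] G.m_assoc)
          have e': "(a \<otimes> inv y) \<otimes> y = a" using a y by (simp add: G.m_assoc)
          have "a \<otimes> inv y \<in> H"
            using inH[OF _ 1] yR G.mem_cut_cases[OF cut y] a y unfolding e by simp
          thus ?thesis using e' a by (intro bexI[of _ "a \<otimes> inv y"]) simp_all
        qed
      next
        assume "\<exists>h\<in>H. a \<preceq> h \<otimes> y"
        then obtain h where "h \<in> H" "a \<preceq> h \<otimes> y" by blast
        hence "y \<notin> fst D" using invar[OF _ y] False G.cut_lower_closed[OF cut] by blast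
        thus "y \<in> snd D" using G.mem_cut_cases[OF cut y] by simp
      qed
      thus ?thesis by blast
    qed
  qed
  thus ?thesis unfolding G.ball_cut_iff[OF cut] by (intro bex_cong) simp_all
qed

end

section \<open>Extensions generated by a realization of a cut\<close>

locale divisible_cut_realization = cut_realization G L \<iota> D x
  for G :: "('a, 'c) ordered_group_scheme" (structure)
    and L :: "('b, 'd) ordered_group_scheme" (structure)
    and \<iota> :: "'a \<Rightarrow> 'b" and D :: "'a set \<times> 'a set" and x :: 'b +
  assumes divisible: "divisible_group G"
    and generated:
      "w \<in> carrier L \<Longrightarrow> \<exists>n::int. \<exists>g\<in>carrier G. w = x [^]\<^bsub>L\<^esub> n \<otimes>\<^bsub>L\<^esub> \<iota> g"
begin

lemma gap_eq_mult:
  assumes "a \<in> carrier G" "b \<in> carrier G"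
  shows "gap a = \<iota> (b \<otimes> inv a) \<otimes>\<^bsub>L\<^esub> gap b"
proof -
  have "\<iota> b \<otimes>\<^bsub>L\<^esub> (inv\<^bsub>L\<^esub> \<iota> a \<otimes>\<^bsub>L\<^esub> inv\<^bsub>L\<^esub> \<iota> b) = inv\<^bsub>L\<^esub> \<iota> a"
    using assms L.m_comm[of "inv\<^bsub>L\<^esub> \<iota> a" "inv\<^bsub>L\<^esub> \<iota> b"] by (simp add: L.m_assoc[symmetric])
  thus ?thesis using assms by (simp add: gap_def L.m_ac)
qed

lemma exists_root:
  assumes "g \<in> carrier G" "n > 0"
  obtains c where "c \<in> carrier G" "c [^] (n::nat) = g"
  using that divisible assms unfolding divisible_group_def by blast

lemma exists_int_root:
  assumes g: "g \<in> carrier G" and n: "n \<noteq> 0"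
  obtains c where "c \<in> carrier G" "c [^] (n::int) = g"
proof -
  have "nat \<bar>n\<bar> > 0" using n by simp
  from exists_root[OF g this] obtain c where c: "c \<in> carrier G" "c [^] nat \<bar>n\<bar> = g" .
  show ?thesis
  proof (cases "n > 0")
    case True
    thus ?thesis using that[OF c(1)] c(2) pow_nat[of n G c] by simp
  next
    case False
    hence "inv c [^] n = c [^] nat \<bar>n\<bar>"
      using c(1) int_pow_def2[of G c n] by (simp add: G.int_pow_inv)
    thus ?thesis using that[of "inv c"] c by simp
  qed
qed

text \<open>The point \<open>a\<close> is \<open>- g / n\<close>: dividing \<open>n x + g\<close> by \<open>n\<close> gives \<open>x - a\<close>. The element
  \<open>x / n\<close> need not exist in \<open>L\<close>, but only \<open>g\<close> has to be divided.\<close>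

lemma int_pow_mult_embed_eq_gap_pow:
  assumes g: "g \<in> carrier G" and n: "n \<noteq> 0"
  obtains a where "a \<in> carrier G" "x [^]\<^bsub>L\<^esub> n \<otimes>\<^bsub>L\<^esub> \<iota> g = gap a [^]\<^bsub>L\<^esub> (n::int)"
proof -
  obtain a where a: "a \<in> carrier G" "a [^] n = inv g" using exists_int_root[OF G.inv_closed[OF g] n] .
  have "gap a [^]\<^bsub>L\<^esub> n = x [^]\<^bsub>L\<^esub> n \<otimes>\<^bsub>L\<^esub> inv\<^bsub>L\<^esub> (\<iota> a [^]\<^bsub>L\<^esub> n)"
    using a(1) by (simp add: gap_def L.int_pow_distrib L.int_pow_inv)
  also have "\<iota> a [^]\<^bsub>L\<^esub> n = \<iota> (inv g)" using a embed.hom_int_pow[of a n] by simp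
  finally show ?thesis using that[OF a(1)] g by simp
qed

text \<open>Nonzero multiples do not change the class, so a class missing from \<open>G\<close> is that of a
  distance \<open>x - a\<close>.\<close>

lemma new_principal_convex_subgroup_eq_gap:
  assumes w: "w \<in> carrier L" "w \<noteq> \<one>\<^bsub>L\<^esub>"
    and new: "\<And>g. g \<in> carrier G \<Longrightarrow> g \<noteq> \<one> \<Longrightarrow>
      principal_convex_subgroup L w \<noteq> principal_convex_subgroup L (\<iota> g)"
  obtains a where "a \<in> carrier G" "principal_convex_subgroup L w = principal_convex_subgroup L (gap a)"
proof -
  obtain n :: int and g where g: "g \<in> carrier G" "w = x [^]\<^bsub>L\<^esub> n \<otimes>\<^bsub>L\<^esub> \<iota> g"
    using generated[OF w(1)] by blast
  have "n \<noteq> 0"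
  proof
    assume "n = 0"
    hence "w = \<iota> g" using g by simp
    moreover from this have "g \<noteq> \<one>" using w(2) by auto
    ultimately show False using new g(1) by blast
  qed
  moreover from int_pow_mult_embed_eq_gap_pow[OF g(1) this]
  obtain a where a: "a \<in> carrier G" "w = gap a [^]\<^bsub>L\<^esub> n" using g(2) by metis
  ultimately show ?thesis using that[OF a(1)] L.principal_convex_subgroup_int_pow by simp
qed

text \<open>For a centre \<open>a\<close> of the ball, \<open>z = x - a\<close> exceeds all multiples of elements of \<open>H\<close> and is
  exceeded by all fractions of elements outside of \<open>H\<close>, so its class is new. Shifting \<open>z\<close> by an
  element of \<open>H\<close> does not change the class, and shifting it by any other element of \<open>G\<close> leads to
  the class of that element.\<close>

lemma increases_rank_if_ball_cut:
  assumes "ball_cut G D"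
  shows "increases_rank G L \<iota>"
proof -
  have conv: "convex_subgroup H G" using G.convex_subgroup_invariance_group[OF cut] .
  hence sub: "subgroup H G" by (simp add: convex_subgroup_def)
  obtain a where a: "a \<in> carrier G"
    and above: "\<And>g. g \<in> carrier G \<Longrightarrow> g \<notin> H \<Longrightarrow> og_abs L (gap a) \<preceq>\<^bsub>L\<^esub> \<iota> (og_abs G g)"
    using assms ball_cut_iff_gap by blast
  define z where "z = gap a"
  have z: "z \<in> carrier L" using a by (simp add: z_def)
  have above: "og_abs L z \<preceq>\<^bsub>L\<^esub> \<iota> (og_abs G g)" if "g \<in> carrier G" "g \<notin> H" for g
    using above that by (simp add: z_def)
  have not_le: "\<not> og_abs L z \<preceq>\<^bsub>L\<^esub> \<iota> (og_abs G h)" if "h \<in> H" for h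
    using that a mem_invariance_group_iff_gap[OF subgroup.mem_carrier[OF sub that]] by (simp add: z_def)
  have below: "\<iota> (og_abs G h) \<preceq>\<^bsub>L\<^esub> og_abs L z" if "h \<in> H" for h
    using not_le[OF that] L.og_total[of "\<iota> (og_abs G h)" "og_abs L z"] z subgroup.mem_carrier[OF sub that]
    by auto
  \<comment> \<open>Fractions of \<open>g\<close> bound \<open>|z|\<close> from above as well, so \<open>g\<close> bounds all multiples of \<open>z\<close>.\<close>
  have root: "\<exists>c\<in>carrier G - H. c [^] Suc n = g" if g: "g \<in> carrier G - H" for g n
  proof -
    from g have "g \<in> carrier G" by simp
    from exists_root[OF this zero_less_Suc] obtain c where c: "c \<in> carrier G" "c [^] Suc n = g" .
    have "c \<notin> H" using G.subgroup_nat_pow_closed[OF sub, of c "Suc n"] c(2) g by auto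
    thus ?thesis using c by blast
  qed
  have new: "principal_convex_subgroup L z \<noteq> principal_convex_subgroup L (\<iota> g)"
    if g: "g \<in> carrier G" for g
  proof
    assume eq: "principal_convex_subgroup L z = principal_convex_subgroup L (\<iota> g)"
    show False
    proof (cases "g \<in> H")
      case True
      have "z \<in> principal_convex_subgroup L (\<iota> g)"
        using L.mem_principal_convex_subgroup_self[OF z] eq by simp
      then obtain n :: nat where "og_abs L z \<preceq>\<^bsub>L\<^esub> og_abs L (\<iota> g) [^]\<^bsub>L\<^esub> n"
        by (auto simp: principal_convex_subgroup_def)
      hence "og_abs L z \<preceq>\<^bsub>L\<^esub> \<iota> (og_abs G (g [^] n))"
        using g by (simp add: embed.hom_nat_pow G.og_abs_pow)
      moreover have "g [^] n \<in> H" using G.subgroup_nat_pow_closed[OF sub True] .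
      ultimately show False using not_le by blast
    next
      case False
      have "\<iota> g \<in> principal_convex_subgroup L z"
        using L.mem_principal_convex_subgroup_self[of "\<iota> g"] g eq by simp
      then obtain n :: nat where n: "og_abs L (\<iota> g) \<preceq>\<^bsub>L\<^esub> og_abs L z [^]\<^bsub>L\<^esub> n"
        by (auto simp: principal_convex_subgroup_def)
      \<comment> \<open>One division more than the exponent \<open>n\<close>, to get the strict \<open>n |z| < |g|\<close> from \<open>|z| \<le> |c|\<close>.\<close>
      obtain c where c: "c \<in> carrier G" "c \<notin> H" "c [^] Suc n = g" using root[of g n] g False by blast
      have "og_abs L z [^]\<^bsub>L\<^esub> n \<preceq>\<^bsub>L\<^esub> \<iota> (og_abs G c) [^]\<^bsub>L\<^esub> n"
        using L.og_pow_mono[OF above[OF c(1,2)]] .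
      from L.og_trans[OF n this] have "\<iota> (og_abs G g) \<preceq>\<^bsub>L\<^esub> \<iota> (og_abs G c [^] n)"
        using g c(1) by (simp add: embed.hom_nat_pow)
      hence "og_abs G g \<preceq> og_abs G c [^] n" using g c(1) by simp
      hence "og_abs G c [^] n \<otimes> og_abs G c \<preceq> og_abs G c [^] n"
        using c G.og_abs_pow[OF c(1), of "Suc n"] by simp
      hence "og_abs G c \<preceq> \<one>"
        using c(1) G.mult_left_le_cancel[of "og_abs G c" \<one> "og_abs G c [^] n"] by simp
      hence "c = \<one>" using c(1) by (simp add: G.og_abs_le_one_iff)
      thus False using c(2) subgroup.one_closed[OF sub] by simp
    qed
  qed
  have all: "principal_convex_subgroup L w = principal_convex_subgroup L z"
    if w: "w \<in> carrier L" "w \<noteq> \<one>\<^bsub>L\<^esub>"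
      and nw: "\<And>g. g \<in> carrier G \<Longrightarrow> g \<noteq> \<one> \<Longrightarrow>
        principal_convex_subgroup L w \<noteq> principal_convex_subgroup L (\<iota> g)" for w
  proof -
    obtain b where b: "b \<in> carrier G" "principal_convex_subgroup L w = principal_convex_subgroup L (gap b)"
      using new_principal_convex_subgroup_eq_gap[OF w nw] by blast
    \<comment> \<open>Additively \<open>g = a - b\<close>, so that \<open>x - b = g + z\<close>.\<close>
    define g where "g = a \<otimes> inv b"
    have g: "g \<in> carrier G" using a b by (simp add: g_def)
    have gb: "gap b = \<iota> g \<otimes>\<^bsub>L\<^esub> z" using gap_eq_mult[OF b(1) a] by (simp add: g_def z_def)
    \<comment> \<open>For \<open>g \<notin> H\<close> the element \<open>g\<close> would dominate in \<open>x - b = g + z\<close>, and the class would not be new.\<close>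
    have gH: "g \<in> H"
    proof (rule ccontr)
      assume gH: "g \<notin> H"
      obtain c where c: "c \<in> carrier G" "c \<notin> H" "c [^] Suc 1 = g" using root[of g 1] g gH by blast
      have "og_abs L z \<otimes>\<^bsub>L\<^esub> og_abs L z \<preceq>\<^bsub>L\<^esub> og_abs L (\<iota> g)"
        using L.mult_mono[OF above[OF c(1,2)] above[OF c(1,2)]] G.og_abs_pow[OF c(1), of "Suc 1"] c g
        by simp
      hence "principal_convex_subgroup L (gap b) = principal_convex_subgroup L (\<iota> g)"
        using L.principal_convex_subgroup_mult_small[OF z, of "\<iota> g"] g gb z by (simp add: L.m_comm)
      moreover have "g \<noteq> \<one>" using gH subgroup.one_closed[OF sub] by blast
      ultimately show False using nw[OF g] b(2) by simp
    qed
    have "og_abs L (\<iota> g) \<otimes>\<^bsub>L\<^esub> og_abs L (\<iota> g) \<preceq>\<^bsub>L\<^esub> og_abs L z"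
      using below[OF subgroup.m_closed[OF sub gH gH]] G.og_abs_pow[OF g, of "Suc 1"] g by simp
    thus ?thesis using L.principal_convex_subgroup_mult_small[OF _ z, of "\<iota> g"] g gb b(2) by simp
  qed
  have "z \<noteq> \<one>\<^bsub>L\<^esub>" using new[of \<one>] by auto
  hence "Prin L - Prin_map L \<iota> ` Prin G = {principal_convex_subgroup L z}"
  proof (intro equalityI subsetI)
    fix K assume "K \<in> Prin L - Prin_map L \<iota> ` Prin G"
    then obtain w where w: "w \<in> carrier L" "w \<noteq> \<one>\<^bsub>L\<^esub>" "K = principal_convex_subgroup L w"
      and nw: "\<And>g. g \<in> carrier G \<Longrightarrow> g \<noteq> \<one> \<Longrightarrow> K \<noteq> principal_convex_subgroup L (\<iota> g)"
      unfolding mem_new_Prin_iff by blast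
    show "K \<in> {principal_convex_subgroup L z}" using all[OF w(1,2)] nw w(3) by simp
  next
    fix K assume "K \<in> {principal_convex_subgroup L z}"
    thus "K \<in> Prin L - Prin_map L \<iota> ` Prin G"
      unfolding mem_new_Prin_iff using new z \<open>z \<noteq> \<one>\<^bsub>L\<^esub>\<close> by blast
  qed
  thus ?thesis by (simp add: increases_rank_def)
qed

text \<open>Any \<open>a\<close> for which the class of \<open>x - a\<close> is new is a centre of the ball: otherwise some \<open>b\<close> is
  closer to \<open>x\<close>, and then \<open>x - a\<close> has the class of an element of \<open>G\<close> built from \<open>b - a\<close>.\<close>

lemma ball_cut_if_increases_rank:
  assumes "increases_rank G L \<iota>"
  shows "ball_cut G D"
proof -
  have sub: "subgroup H G"
    using G.convex_subgroup_invariance_group[OF cut] by (simp add: convex_subgroup_def)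
  obtain K where "K \<in> Prin L - Prin_map L \<iota> ` Prin G"
    using assms by (auto simp: increases_rank_def is_singleton_def)
  then obtain w where w: "w \<in> carrier L" "w \<noteq> \<one>\<^bsub>L\<^esub>"
    and "\<And>g. g \<in> carrier G \<Longrightarrow> g \<noteq> \<one> \<Longrightarrow>
      principal_convex_subgroup L w \<noteq> principal_convex_subgroup L (\<iota> g)"
    unfolding mem_new_Prin_iff by blast
  then obtain a where a: "a \<in> carrier G"
    and new: "\<And>g. g \<in> carrier G \<Longrightarrow> g \<noteq> \<one> \<Longrightarrow>
      principal_convex_subgroup L (gap a) \<noteq> principal_convex_subgroup L (\<iota> g)"
    using new_principal_convex_subgroup_eq_gap[OF w] by metis
  have "og_abs L (gap a) \<preceq>\<^bsub>L\<^esub> \<iota> (og_abs G g)" if g: "g \<in> carrier G - H" for g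
  proof (rule ccontr)
    assume neg: "\<not> og_abs L (gap a) \<preceq>\<^bsub>L\<^esub> \<iota> (og_abs G g)"
    have gc: "g \<in> carrier G" "g \<notin> H" using g by auto
    interpret P: subgroup "principal_convex_subgroup L (gap a)" L
      using L.subgroup_principal_convex_subgroup a by simp
    have gle: "\<iota> (og_abs G g) \<preceq>\<^bsub>L\<^esub> og_abs L (gap a)"
      using neg L.og_total[of "\<iota> (og_abs G g)" "og_abs L (gap a)"] a gc by auto
    obtain b where b: "b \<in> carrier G" "og_abs L (gap b) \<preceq>\<^bsub>L\<^esub> \<iota> (og_abs G g)"
      using mem_invariance_group_iff_gap[OF gc(1)] gc(2) by blast
    define d where "d = b \<otimes> inv a"
    \<comment> \<open>This \<open>c\<close> is equivalent to \<open>x - a\<close>: \<open>|x - a| \<le> |x - b| + |b - a| \<le> c\<close>, and \<open>|g|\<close>, \<open>x - b\<close> and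
      hence \<open>b - a\<close> are dominated by \<open>x - a\<close>.\<close>
    define c where "c = og_abs G g \<otimes> og_abs G d"
    have cd: "d \<in> carrier G" "c \<in> carrier G" using a b gc by (simp_all add: d_def c_def)
    have eq: "gap a = \<iota> d \<otimes>\<^bsub>L\<^esub> gap b" using gap_eq_mult[OF a b(1)] by (simp add: d_def)
    have c1: "\<one> \<preceq> c" using G.one_le_mult cd gc by (simp add: c_def)
    have "og_abs L (\<iota> d) \<otimes>\<^bsub>L\<^esub> og_abs L (gap b) \<preceq>\<^bsub>L\<^esub> \<iota> (og_abs G d) \<otimes>\<^bsub>L\<^esub> \<iota> (og_abs G g)"
      using L.mult_mono[OF L.og_refl b(2), of "og_abs L (\<iota> d)"] cd by simp
    moreover have "\<iota> (og_abs G d) \<otimes>\<^bsub>L\<^esub> \<iota> (og_abs G g) = og_abs L (\<iota> c)"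
      using cd gc c1 by (simp add: G.og_abs_of_one_le) (simp add: c_def L.m_comm)
    ultimately have "og_abs L (gap a) \<preceq>\<^bsub>L\<^esub> og_abs L (\<iota> c)"
      using L.og_trans[OF L.og_abs_triangle[of "\<iota> d" "gap b"]] cd b(1) eq by simp
    hence 1: "gap a \<in> principal_convex_subgroup L (\<iota> c)"
      using cd a by (intro L.mem_principal_convex_subgroup_if_le) simp_all
    have gP: "\<iota> (og_abs G g) \<in> principal_convex_subgroup L (gap a)"
      using gle gc a by (intro L.mem_principal_convex_subgroup_if_le) (simp_all add: G.og_abs_of_one_le)
    have "gap b \<in> principal_convex_subgroup L (gap a)"
      using L.og_trans[OF b(2) gle] a b(1) by (intro L.mem_principal_convex_subgroup_if_le) simp_all
    hence "gap a \<otimes>\<^bsub>L\<^esub> inv\<^bsub>L\<^esub> gap b \<in> principal_convex_subgroup L (gap a)"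
      using L.mem_principal_convex_subgroup_self[of "gap a"] a by simp
    moreover have "gap a \<otimes>\<^bsub>L\<^esub> inv\<^bsub>L\<^esub> gap b = \<iota> d"
      using eq cd b(1) by (simp add: L.m_assoc)
    ultimately have "og_abs L (\<iota> d) \<in> principal_convex_subgroup L (gap a)"
      using L.mem_og_abs_iff[OF P.subgroup_axioms, of "\<iota> d"] cd by simp
    hence "\<iota> c \<in> principal_convex_subgroup L (gap a)"
      using gP cd gc by (simp add: c_def)
    with 1 have "principal_convex_subgroup L (gap a) = principal_convex_subgroup L (\<iota> c)"
      by (rule L.principal_convex_subgroup_eqI)
    moreover have "c \<noteq> \<one>"
    proof
      assume "c = \<one>"
      hence "og_abs G g = \<one>" using G.one_le_mult_eq[of "og_abs G g" "og_abs G d"] cd gc by (simp add: c_def)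
      hence "g = \<one>" using G.og_abs_le_one_iff[OF gc(1)] by simp
      thus False using gc(2) subgroup.one_closed[OF sub] by simp
    qed
    ultimately show False using new cd by blast
  qed
  thus ?thesis using ball_cut_iff_gap a by blast
qed

end

lemma divisible_cut_realization_cut_ext:
  fixes \<Gamma> :: "('a, 'b) ordered_group_scheme"
  assumes "ordered_comm_group \<Gamma>" and div: "divisible_group \<Gamma>" and D: "is_cut \<Gamma> D"
  shows "divisible_cut_realization \<Gamma> (cut_ext \<Gamma> D) cut_ext_embed D (cut_ext_gen \<Gamma>)"
proof -
  interpret G: ordered_comm_group \<Gamma> by fact
  define E where "E = cut_ext \<Gamma> D"
  have E: "carrier E = UNIV \<times> carrier \<Gamma>" "\<one>\<^bsub>E\<^esub> = (0, \<one>\<^bsub>\<Gamma>\<^esub>)"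
    "\<And>m n a b. (m, a) \<otimes>\<^bsub>E\<^esub> (n, b) = (m + n, a \<otimes>\<^bsub>\<Gamma>\<^esub> b)"
    by (simp_all add: E_def cut_ext_def)
  have "is_cut_ext_order \<Gamma> D (ord_rel E)"
    using G.is_cut_ext_order_cut_ext[OF D div] by (simp add: E_def)
  moreover have "with_order (integer_group \<times>\<times> \<Gamma>) (ord_rel E) = E"
    by (simp add: E_def cut_ext_def with_order_def)
  ultimately have ext: "ordered_comm_group E"
    "\<And>a b. a \<in> carrier \<Gamma> \<Longrightarrow> b \<in> carrier \<Gamma> \<Longrightarrow>
      cut_ext_embed a \<preceq>\<^bsub>E\<^esub> cut_ext_embed b \<longleftrightarrow> a \<preceq>\<^bsub>\<Gamma>\<^esub> b"
    "\<And>a. a \<in> fst D \<Longrightarrow> cut_ext_embed a \<prec>\<^bsub>E\<^esub> cut_ext_gen \<Gamma>"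
    "\<And>b. b \<in> snd D \<Longrightarrow> cut_ext_gen \<Gamma> \<prec>\<^bsub>E\<^esub> cut_ext_embed b"
    by (simp_all add: is_cut_ext_order_def Let_def)
  interpret L: ordered_comm_group E by (rule ext(1))
  have hom: "cut_ext_embed \<in> hom \<Gamma> E" by (auto simp: hom_def E cut_ext_embed_def)
  have pow: "cut_ext_gen \<Gamma> [^]\<^bsub>E\<^esub> (m::nat) = (int m, \<one>\<^bsub>\<Gamma>\<^esub>)" for m
    by (induction m) (simp_all add: E cut_ext_gen_def add.commute)
  have inv: "inv\<^bsub>E\<^esub> (m, \<one>\<^bsub>\<Gamma>\<^esub>) = (- m, \<one>\<^bsub>\<Gamma>\<^esub>)" for m
    by (rule L.inv_equality) (simp_all add: E)
  have ipow: "cut_ext_gen \<Gamma> [^]\<^bsub>E\<^esub> n = (n, \<one>\<^bsub>\<Gamma>\<^esub>)" for n :: int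
    using int_pow_def2[of E "cut_ext_gen \<Gamma>" n] by (simp add: pow inv)
  have "divisible_cut_realization \<Gamma> E cut_ext_embed D (cut_ext_gen \<Gamma>)"
  proof
    show "\<exists>n::int. \<exists>g\<in>carrier \<Gamma>. w = cut_ext_gen \<Gamma> [^]\<^bsub>E\<^esub> n \<otimes>\<^bsub>E\<^esub> cut_ext_embed g"
      if "w \<in> carrier E" for w
    proof (intro exI bexI)
      show "w = cut_ext_gen \<Gamma> [^]\<^bsub>E\<^esub> fst w \<otimes>\<^bsub>E\<^esub> cut_ext_embed (snd w)"
        "snd w \<in> carrier \<Gamma>"
        using that by (auto simp: E ipow cut_ext_embed_def)
    qed
  qed (use hom ext D div in \<open>simp_all add: cut_ext_gen_def E\<close>)
  thus ?thesis by (simp add: E_def)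
qed

theorem theorem3p8:
  fixes \<Gamma> :: "('a, 'b) ordered_group_scheme" and D :: "'a set \<times> 'a set"
  assumes "ordered_comm_group \<Gamma>"
    and "divisible_group \<Gamma>"
    and "is_cut \<Gamma> D"
  shows "increases_rank \<Gamma> (cut_ext \<Gamma> D) cut_ext_embed \<longleftrightarrow> ball_cut \<Gamma> D"
proof -
  interpret divisible_cut_realization \<Gamma> "cut_ext \<Gamma> D" cut_ext_embed D "cut_ext_gen \<Gamma>"
    by (rule divisible_cut_realization_cut_ext) fact+
  show ?thesis using increases_rank_if_ball_cut ball_cut_if_increases_rank by blast
qed

end
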